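(* Let $F=I\circ G$ be the (one-dimensional) gliders with reflecting walls, and let $\theta$ be a positive birth-death noise. Then the noisy version of $F$ with noise $\theta$ is uniformly ergodic, with an invariant measure that is spatially mixing and admits a perfect sampling algorithm.
   Context: Let $S=\{0,1\}^3$ with components indexed, in this order, by $\mathtt{W},\mathtt{R},\mathtt{L}$ (walls, right-moving particles, left-moving particles), and $\mathcal{X}=S^{\mathbb{Z}}$ with the product topology; $x_{k,i}$ is the component $i\in\{\mathtt{W},\mathtt{R},\mathtt{L}\}$ of $x_k$. For finite $K\subseteq\mathbb{Z}$ and $y_K\in S^K$, the cylinder $[y_K]$ is $\{x\in\mathcal{X}: x_k=y_k\ \forall k\in K\}$. The shift is $(\sigma^k x)_i=x_{k+i}$. $G:\mathcal{X}\to\mathcal{X}$ keeps walls fixed, moves $\mathtt{R}$-particles one unit to the right and $\mathtt{L}$-particles one unit to the left: $(Gx)_{k,\mathtt{W}}=x_{k,\mathtt{W}}$, $(Gx)_{k,\mathtt{R}}=x_{k-1,\mathtt{R}}$, $(Gx)_{k,\mathtt{L}}=x_{k+1,\mathtt{L}}$. The reflection rule $I:\mathcal{X}\to\mathcal{X}$ is: $(Ix)_k=(1,0,1)$ if $x_k=(1,1,0)$; $(Ix)_k=(1,1,0)$ if $x_k=(1,0,1)$; $(Ix)_k=x_k$ otherwise. A birth-death noise is a stochastic matrix $\theta(a,b)=\prod_{i\in\{\mathtt{W},\mathtt{R},\mathtt{L}\}}\theta_i(a_i,b_i)$ on $S$ with $\theta_i=\begin{pmatrix}1-\beta_i&\beta_i\\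 \delta_i&1-\delta_i\end{pmatrix}$ (rows and columns indexed by $0,1$); it is positive if $\beta_i,\delta_i\in(0,1)$ for all $i$. The noisy version of $F$ with noise $\theta$ is the Markov kernel $\Phi$ on $\mathcal{X}$ given by $\Phi(x,[y_K])=\prod_{k\in K}\theta\big((Fx)_k,y_k\big)$ for every cylinder. A Borel probability measure $\pi$ is invariant if $\pi\Phi=\pi$. $\Phi$ is uniformly ergodic if it has a unique invariant measure $\pi$ and $\Phi^t(x,[u])\to\pi([u])$ as $t\to\infty$, uniformly in $x\in\mathcal{X}$, for each cylinder $[u]$. $\pi$ is spatially mixing if $\lim_{|k|\to\infty}\pi([u]\cap\sigma^{-k}[v])=\pi([u])\pi([v])$ for all cylinders $[u],[v]$. A perfect sampling algorithm for a probability measure $\mu$ on $\mathcal{X}$ is an algorithm that, given a finite set $A\subseteq\mathbb{Z}$ and using an unbounded source of independent uniform samples from $[0,1]$ (and with access to a symbolic presentation of the real transition probabilities of the PCA), outputs a random pattern $W_A\in S^A$ with $\mathbb{P}(W_A=w)=\mu([w])$ for all $w\in S^A$. *)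

theory Defs
  imports "HOL-Probability.Probability"
begin

section \<open>Configurations\<close>

datatype comp = W | R | L

lemma UNIV_comp: "UNIV = {W, R, L}"
  using comp.exhaust by auto

instance comp :: finite
  by standard (simp add: UNIV_comp)

type_synonym cell = "comp \<Rightarrow> bool"
type_synonym conf = "int \<Rightarrow> cell"

text \<open>The triple notation for cells; the components are listed in the order \<^const>\<open>W\<close>, \<^const>\<open>R\<close>,
  \<^const>\<open>L\<close>.\<close>

definition cell :: "bool \<Rightarrow> bool \<Rightarrow> bool \<Rightarrow> cell" where
  "cell w r l = (\<lambda>i. case i of W \<Rightarrow> w | R \<Rightarrow> r | L \<Rightarrow> l)"

text \<open>A pattern on \<open>K\<close> is represented by any total function extending it: only the values on \<open>K\<close>
  matter.\<close>

definition cylinder :: "int set \<Rightarrow> (int \<Rightarrow> cell) \<Rightarrow> conf set" where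
  "cylinder K y = {x. \<forall>k\<in>K. x k = y k}"

definition shift :: "int \<Rightarrow> conf \<Rightarrow> conf" where
  "shift k x = (\<lambda>i. x (k + i))"

section \<open>Gliders with reflecting walls\<close>

definition glide :: "conf \<Rightarrow> conf" where
  "glide x = (\<lambda>k i. case i of W \<Rightarrow> x k W | R \<Rightarrow> x (k - 1) R | L \<Rightarrow> x (k + 1) L)"

definition reflect :: "conf \<Rightarrow> conf" where
  "reflect x = (\<lambda>k.
     if x k = cell True True False then cell True False True
     else if x k = cell True False True then cell True True False
     else x k)"

definition gliders :: "conf \<Rightarrow> conf" where
  "gliders = reflect \<circ> glide"

section \<open>Noise\<close>

definition birth_death1 :: "real \<Rightarrow> real \<Rightarrow> bool \<Rightarrow> bool \<Rightarrow> real" where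
  "birth_death1 \<beta> \<delta> a b =
     (if a then (if b then 1 - \<delta> else \<delta>) else (if b then \<beta> else 1 - \<beta>))"

definition birth_death :: "(comp \<Rightarrow> real) \<Rightarrow> (comp \<Rightarrow> real) \<Rightarrow> cell \<Rightarrow> cell \<Rightarrow> real" where
  "birth_death \<beta> \<delta> a b = (\<Prod>i\<in>UNIV. birth_death1 (\<beta> i) (\<delta> i) (a i) (b i))"

definition positive_rates :: "(comp \<Rightarrow> real) \<Rightarrow> (comp \<Rightarrow> real) \<Rightarrow> bool" where
  "positive_rates \<beta> \<delta> \<longleftrightarrow> (\<forall>i. \<beta> i \<in> {0<..<1} \<and> \<delta> i \<in> {0<..<1})"

definition stochastic :: "(cell \<Rightarrow> cell \<Rightarrow> real) \<Rightarrow> bool" where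
  "stochastic \<theta> \<longleftrightarrow> (\<forall>a b. 0 \<le> \<theta> a b) \<and> (\<forall>a. (\<Sum>b\<in>UNIV. \<theta> a b) = 1)"

text \<open>Here and below \<open>borel\<close> is the Borel \<open>\<sigma>\<close>-algebra of the product topology on \<^typ>\<open>conf\<close>, and
  a Markov kernel is a measurable map into the probability measures on it.\<close>

definition noisy_version ::
  "(conf \<Rightarrow> conf) \<Rightarrow> (cell \<Rightarrow> cell \<Rightarrow> real) \<Rightarrow> (conf \<Rightarrow> conf measure) \<Rightarrow> bool" where
  "noisy_version F \<theta> \<Phi> \<longleftrightarrow>
     \<Phi> \<in> borel \<rightarrow>\<^sub>M prob_algebra borel \<and>
     (\<forall>x K y. finite K \<longrightarrow> measure (\<Phi> x) (cylinder K y) = (\<Prod>k\<in>K. \<theta> (F x k) (y k)))"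

section \<open>Ergodicity and mixing\<close>

primrec kernel_power :: "(conf \<Rightarrow> conf measure) \<Rightarrow> nat \<Rightarrow> conf \<Rightarrow> conf measure" where
  "kernel_power \<Phi> 0 x = return borel x"
| "kernel_power \<Phi> (Suc t) x = kernel_power \<Phi> t x \<bind> \<Phi>"

definition invariant :: "(conf \<Rightarrow> conf measure) \<Rightarrow> conf measure \<Rightarrow> bool" where
  "invariant \<Phi> \<pi> \<longleftrightarrow> prob_space \<pi> \<and> sets \<pi> = sets borel \<and> \<pi> \<bind> \<Phi> = \<pi>"

definition uniformly_ergodic :: "(conf \<Rightarrow> conf measure) \<Rightarrow> bool" where
  "uniformly_ergodic \<Phi> \<longleftrightarrow>
     (\<exists>\<pi>. invariant \<Phi> \<pi> \<and> (\<forall>\<pi>'. invariant \<Phi> \<pi>' \<longrightarrow> \<pi>' = \<pi>) \<and>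
        (\<forall>K u. finite K \<longrightarrow>
           uniform_limit UNIV (\<lambda>t x. measure (kernel_power \<Phi> t x) (cylinder K u))
             (\<lambda>x. measure \<pi> (cylinder K u)) sequentially))"

definition spatially_mixing :: "conf measure \<Rightarrow> bool" where
  "spatially_mixing \<pi> \<longleftrightarrow>
     (\<forall>K u J v. finite K \<longrightarrow> finite J \<longrightarrow>
        ((\<lambda>k. measure \<pi> (cylinder K u \<inter> shift (- k) ` cylinder J v)) \<longlongrightarrow>
           measure \<pi> (cylinder K u) * measure \<pi> (cylinder J v))
        (filtercomap (\<lambda>k::int. \<bar>k\<bar>) at_top))"

section \<open>Perfect sampling\<close>

text \<open>
  Algorithms are programs of a real random access machine, that is, while programs over two
  memories, one for integers and one for real numbers. Each memory consists of arrays, which are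
  named by natural numbers and indexed by integers. Integer and real arithmetic and comparisons are
  exact, and reals cannot be converted to integers other than by branching on comparisons. The
  transition probabilities \<open>\<theta> a b\<close> occur as constants \<open>Prob a b\<close> (apart from which the only numerical
  constants are integers), and \<open>Sample a e\<close> stores a fresh uniform sample. A program is a finite
  object, with no access to the measure to be sampled.
\<close>

datatype iexp =
    IConst int
  | IGet nat iexp
  | IAdd iexp iexp
  | ISub iexp iexp
  | IMul iexp iexp
  | IDiv iexp iexp
  | IMod iexp iexp

datatype rexp =
    Prob cell cell
  | OfInt iexp
  | RGet nat iexp
  | RAdd rexp rexp
  | RSub rexp rexp
  | RMul rexp rexp
  | RDiv rexp rexp

datatype bexp =
    ILess iexp iexp
  | RLess rexp rexp
  | BNot bexp
  | BAnd bexp bexp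

datatype prog =
    Skip
  | ISet nat iexp iexp
  | RSet nat iexp rexp
  | Sample nat iexp
  | Seq prog prog
  | Cond bexp prog prog
  | While bexp prog

record memory =
  ints :: "nat \<Rightarrow> int \<Rightarrow> int"
  reals :: "nat \<Rightarrow> int \<Rightarrow> real"
  used :: nat  \<comment> \<open>number of samples consumed so far\<close>

primrec ival :: "memory \<Rightarrow> iexp \<Rightarrow> int" where
  "ival s (IConst c) = c"
| "ival s (IGet a e) = ints s a (ival s e)"
| "ival s (IAdd e f) = ival s e + ival s f"
| "ival s (ISub e f) = ival s e - ival s f"
| "ival s (IMul e f) = ival s e * ival s f"
| "ival s (IDiv e f) = ival s e div ival s f"
| "ival s (IMod e f) = ival s e mod ival s f"

primrec rval :: "(cell \<Rightarrow> cell \<Rightarrow> real) \<Rightarrow> memory \<Rightarrow> rexp \<Rightarrow> real" where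
  "rval \<theta> s (Prob a b) = \<theta> a b"
| "rval \<theta> s (OfInt e) = of_int (ival s e)"
| "rval \<theta> s (RGet a e) = reals s a (ival s e)"
| "rval \<theta> s (RAdd e f) = rval \<theta> s e + rval \<theta> s f"
| "rval \<theta> s (RSub e f) = rval \<theta> s e - rval \<theta> s f"
| "rval \<theta> s (RMul e f) = rval \<theta> s e * rval \<theta> s f"
| "rval \<theta> s (RDiv e f) = rval \<theta> s e / rval \<theta> s f"

primrec bval :: "(cell \<Rightarrow> cell \<Rightarrow> real) \<Rightarrow> memory \<Rightarrow> bexp \<Rightarrow> bool" where
  "bval \<theta> s (ILess e f) \<longleftrightarrow> ival s e < ival s f"
| "bval \<theta> s (RLess e f) \<longleftrightarrow> rval \<theta> s e < rval \<theta> s f"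
| "bval \<theta> s (BNot b) \<longleftrightarrow> \<not> bval \<theta> s b"
| "bval \<theta> s (BAnd b c) \<longleftrightarrow> bval \<theta> s b \<and> bval \<theta> s c"

definition store :: "nat \<Rightarrow> int \<Rightarrow> 'v \<Rightarrow> (nat \<Rightarrow> int \<Rightarrow> 'v) \<Rightarrow> nat \<Rightarrow> int \<Rightarrow> 'v" where
  "store a j v m = m(a := (m a)(j := v))"

text \<open>\<open>exec \<theta> \<omega> P s s'\<close>: reading the samples \<open>\<omega> 0, \<omega> 1, \<dots>\<close>, the program \<open>P\<close> started in \<open>s\<close>
  terminates in \<open>s'\<close>.\<close>

inductive exec ::
  "(cell \<Rightarrow> cell \<Rightarrow> real) \<Rightarrow> (nat \<Rightarrow> real) \<Rightarrow> prog \<Rightarrow> memory \<Rightarrow> memory \<Rightarrow> bool"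
  for \<theta> \<omega> where
  exec_Skip: "exec \<theta> \<omega> Skip s s"
| exec_ISet: "exec \<theta> \<omega> (ISet a e f) s (s\<lparr>ints := store a (ival s e) (ival s f) (ints s)\<rparr>)"
| exec_RSet: "exec \<theta> \<omega> (RSet a e f) s (s\<lparr>reals := store a (ival s e) (rval \<theta> s f) (reals s)\<rparr>)"
| exec_Sample: "exec \<theta> \<omega> (Sample a e) s
    (s\<lparr>reals := store a (ival s e) (\<omega> (used s)) (reals s), used := Suc (used s)\<rparr>)"
| exec_Seq: "exec \<theta> \<omega> P s s' \<Longrightarrow> exec \<theta> \<omega> Q s' s'' \<Longrightarrow> exec \<theta> \<omega> (Seq P Q) s s''"
| exec_CondT: "bval \<theta> s b \<Longrightarrow> exec \<theta> \<omega> P s s' \<Longrightarrow> exec \<theta> \<omega> (Cond b P Q) s s'"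
| exec_CondF: "\<not> bval \<theta> s b \<Longrightarrow> exec \<theta> \<omega> Q s s' \<Longrightarrow> exec \<theta> \<omega> (Cond b P Q) s s'"
| exec_WhileT: "bval \<theta> s b \<Longrightarrow> exec \<theta> \<omega> P s s' \<Longrightarrow> exec \<theta> \<omega> (While b P) s' s'' \<Longrightarrow>
    exec \<theta> \<omega> (While b P) s s''"
| exec_WhileF: "\<not> bval \<theta> s b \<Longrightarrow> exec \<theta> \<omega> (While b P) s s"

text \<open>The input \<open>A\<close> is placed in integer array \<open>0\<close>: its cardinality in cell \<open>0\<close>, then its elements in
  increasing order in cells \<open>1, \<dots>, card A\<close>. Everything else is \<open>0\<close>.\<close>

definition input :: "int set \<Rightarrow> memory" where
  "input A =
     \<lparr>ints = (\<lambda>a j.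
        if a = 0 \<and> j = 0 then int (card A)
        else if a = 0 \<and> 1 \<le> j \<and> j \<le> int (card A) then sorted_list_of_set A ! nat (j - 1)
        else 0),
      reals = (\<lambda>a j. 0), used = 0\<rparr>"

text \<open>The output pattern is read off from the integer arrays \<open>1\<close>, \<open>2\<close>, \<open>3\<close>, at the indices in \<open>A\<close>.\<close>

definition out_array :: "comp \<Rightarrow> nat" where
  "out_array i = (case i of W \<Rightarrow> 1 | R \<Rightarrow> 2 | L \<Rightarrow> 3)"

definition outputs ::
  "(cell \<Rightarrow> cell \<Rightarrow> real) \<Rightarrow> prog \<Rightarrow> int set \<Rightarrow> (nat \<Rightarrow> real) \<Rightarrow> (int \<Rightarrow> cell) \<Rightarrow> bool" where
  "outputs \<theta> P A \<omega> w \<longleftrightarrow>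
     (\<exists>s. exec \<theta> \<omega> P (input A) s \<and> (\<forall>k\<in>A. \<forall>i. ints s (out_array i) k = of_bool (w k i)))"

definition uniform_samples :: "(nat \<Rightarrow> real) measure" where
  "uniform_samples = (\<Pi>\<^sub>M n\<in>UNIV. uniform_measure lborel {0..1})"

text \<open>Almost sure termination on every input is implied: for fixed \<open>A\<close>, the probabilities below
  sum to \<open>1\<close> over the patterns \<open>w\<close> on \<open>A\<close>.\<close>

definition perfect_sampler :: "(cell \<Rightarrow> cell \<Rightarrow> real) \<Rightarrow> prog \<Rightarrow> conf measure \<Rightarrow> bool" where
  "perfect_sampler \<theta> P \<mu> \<longleftrightarrow>
     (\<forall>A w. finite A \<longrightarrow>
        {\<omega> \<in> space uniform_samples. outputs \<theta> P A \<omega> w} \<in> sets uniform_samples \<and>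
        measure uniform_samples {\<omega> \<in> space uniform_samples. outputs \<theta> P A \<omega> w} =
          measure \<mu> (cylinder A w))"

definition admits_perfect_sampling :: "(cell \<Rightarrow> cell \<Rightarrow> real) \<Rightarrow> conf measure \<Rightarrow> bool" where
  "admits_perfect_sampling \<theta> \<mu> \<longleftrightarrow> (\<exists>P. perfect_sampler \<theta> P \<mu>)"

section \<open>Sanity checks\<close>

inductive_cases SkipE: "exec \<theta> \<omega> Skip s s'"
inductive_cases ISetE: "exec \<theta> \<omega> (ISet a e f) s s'"
inductive_cases RSetE: "exec \<theta> \<omega> (RSet a e f) s s'"
inductive_cases SampleE: "exec \<theta> \<omega> (Sample a e) s s'"
inductive_cases SeqE: "exec \<theta> \<omega> (Seq P Q) s s'"
inductive_cases CondE: "exec \<theta> \<omega> (Cond b P Q) s s'"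
inductive_cases WhileE: "exec \<theta> \<omega> (While b P) s s'"

lemma exec_deterministic: "exec \<theta> \<omega> P s s' \<Longrightarrow> exec \<theta> \<omega> P s s'' \<Longrightarrow> s'' = s'"
proof (induction arbitrary: s'' rule: exec.induct)
  case (exec_Seq P s s' Q t)
  then show ?case by (metis SeqE)
next
  case (exec_WhileT s b P s' t)
  then show ?case by (metis WhileE)
qed (blast elim: SkipE ISetE RSetE SampleE CondE WhileE)+

lemma stochastic_birth_death:
  assumes "positive_rates \<beta> \<delta>"
  shows "stochastic (birth_death \<beta> \<delta>)"
proof -
  have rates: "0 \<le> birth_death1 (\<beta> i) (\<delta> i) a b" for i a b
    using assms by (auto simp: positive_rates_def birth_death1_def less_imp_le)
  have row: "(\<Sum>b\<in>UNIV. birth_death1 (\<beta> i) (\<delta> i) a b) = 1" for i a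
    unfolding UNIV_bool by (simp add: birth_death1_def)
  have "(\<Sum>b\<in>UNIV. birth_death \<beta> \<delta> a b) = 1" for a
  proof -
    have "(\<Sum>b\<in>UNIV. birth_death \<beta> \<delta> a b) =
        (\<Sum>b\<in>(\<Pi>\<^sub>E i\<in>UNIV. UNIV). \<Prod>i\<in>UNIV. birth_death1 (\<beta> i) (\<delta> i) (a i) (b i))"
      by (simp add: birth_death_def PiE_UNIV_domain)
    also have "\<dots> = (\<Prod>i\<in>UNIV. \<Sum>b\<in>UNIV. birth_death1 (\<beta> i) (\<delta> i) (a i) b)"
      by (subst prod_sum_PiE) auto
    finally show ?thesis by (simp add: row)
  qed
  with rates show ?thesis
    by (auto simp: stochastic_def birth_death_def intro!: prod_nonneg)
qed

instance bool :: second_countable_topology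
proof
  show "\<exists>B::bool set set. countable B \<and> open = generate_topology B"
    by (intro exI[of _ UNIV])
      (auto simp: fun_eq_iff discrete_topology_class.open_discrete countable_finite intro: generate_topology.Basis)
qed

lemma sets_cell: "sets (borel :: cell measure) = sets (count_space UNIV)"
proof -
  have "open {a}" for a :: cell
  proof -
    have "{a} = (\<Pi>\<^sub>E i\<in>UNIV. {a i})" by (auto simp: PiE_UNIV_domain)
    then show ?thesis using open_PiE[of "\<lambda>i. {a i}"] by (simp add: discrete_topology_class.open_discrete)
  qed
  then have "open A" for A :: "cell set"
    using open_Union[of "(\<lambda>a. {a}) ` A"] by auto
  then show ?thesis by auto
qed

lemma sets_conf: "sets (\<Pi>\<^sub>M k\<in>UNIV. count_space UNIV) = sets (borel :: conf measure)"
proof -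
  have "sets (\<Pi>\<^sub>M k\<in>(UNIV :: int set). count_space (UNIV :: cell set)) =
      sets (\<Pi>\<^sub>M k\<in>(UNIV :: int set). (borel :: cell measure))"
    by (intro sets_PiM_cong) (simp_all only: sets_cell)
  also have "\<dots> = sets (borel :: conf measure)" by (rule sets_PiM_equal_borel)
  finally show ?thesis .
qed

lemma measurable_coordinate:
  assumes "F \<in> M \<rightarrow>\<^sub>M (borel :: conf measure)"
  shows "(\<lambda>x. F x k) \<in> M \<rightarrow>\<^sub>M count_space UNIV"
proof -
  have "(\<lambda>y::conf. y k) \<in> borel \<rightarrow>\<^sub>M borel"
    by (intro borel_measurable_continuous_onI continuous_on_product_coordinates)
  then have "(\<lambda>x. F x k) \<in> M \<rightarrow>\<^sub>M borel" using assms by (rule measurable_compose[rotated])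
  then show ?thesis using measurable_cong_sets[OF refl sets_cell] by blast
qed

lemma noisy_version_exists:
  assumes F: "F \<in> borel \<rightarrow>\<^sub>M borel" and \<theta>: "stochastic \<theta>"
  shows "\<exists>\<Phi>. noisy_version F \<theta> \<Phi>"
proof -
  define p where "p a = embed_pmf (\<theta> a)" for a
  have p: "pmf (p a) b = \<theta> a b" for a b
    using \<theta> unfolding p_def stochastic_def
    by (intro pmf_embed_pmf) (auto simp: nn_integral_count_space_finite sum_ennreal)
  define \<Phi> where "\<Phi> x = (\<Pi>\<^sub>M k\<in>UNIV. measure_pmf (p (F x k)))" for x
  have sets: "sets (\<Phi> x) = sets borel" for x
    unfolding \<Phi>_def sets_conf[symmetric] by (intro sets_PiM_cong) auto
  have prob: "prob_space (\<Phi> x)" for x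
    unfolding \<Phi>_def by (intro prob_space_PiM prob_space_measure_pmf)
  have em: "emeasure (\<Phi> x) (prod_emb UNIV (\<lambda>_. count_space UNIV) J (Pi\<^sub>E J X)) =
      (\<Prod>k\<in>J. emeasure (measure_pmf (p (F x k))) (X k))" if "finite J" for x J X
  proof -
    have "prod_emb UNIV (\<lambda>_. count_space UNIV) J (Pi\<^sub>E J X) =
        prod_emb UNIV (\<lambda>k. measure_pmf (p (F x k))) J (Pi\<^sub>E J X)"
      by (simp add: prod_emb_def)
    then show ?thesis
      unfolding \<Phi>_def using that by (simp add: emeasure_PiM_emb prob_space_measure_pmf)
  qed
  have "\<Phi> \<in> borel \<rightarrow>\<^sub>M prob_algebra borel"
  proof (rule measurable_prob_algebra_generated)
    show "sets (borel :: conf measure) = sigma_sets (\<Pi>\<^sub>E k\<in>UNIV. space (count_space UNIV))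
        (prod_algebra UNIV (\<lambda>_. count_space UNIV))"
      unfolding sets_conf[symmetric] by (rule sets_PiM)
    fix A :: "conf set" assume "A \<in> prod_algebra UNIV (\<lambda>_. count_space UNIV)"
    then obtain J X where A: "A = prod_emb UNIV (\<lambda>_. count_space UNIV) J (Pi\<^sub>E J X)" "finite J"
      by (auto elim!: prod_algebraE)
    have "(\<lambda>x. emeasure (measure_pmf (p (F x k))) (X k)) \<in> borel_measurable borel" for k
      by (rule measurable_compose[OF measurable_coordinate[OF F]]) simp
    then show "(\<lambda>x. emeasure (\<Phi> x) A) \<in> borel_measurable borel"
      unfolding A(1) em[OF A(2)] by measurable
  qed (use sets prob prod_algebra_sets_into_space in \<open>auto intro: Int_stable_prod_algebra\<close>)
  moreover have "measure (\<Phi> x) (cylinder K y) = (\<Prod>k\<in>K. \<theta> (F x k) (y k))" if "finite K" for x K y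
  proof -
    have "cylinder K y = prod_emb UNIV (\<lambda>_. count_space UNIV) K (\<Pi>\<^sub>E k\<in>K. {y k})"
      by (auto simp: cylinder_def prod_emb_def PiE_iff)
    then have "emeasure (\<Phi> x) (cylinder K y) = (\<Prod>k\<in>K. ennreal (\<theta> (F x k) (y k)))"
      using em[OF that] by (simp add: emeasure_pmf_single p)
    also have "\<dots> = ennreal (\<Prod>k\<in>K. \<theta> (F x k) (y k))"
      using \<theta> by (intro prod_ennreal) (auto simp: stochastic_def)
    finally show ?thesis
      using \<theta> by (simp add: measure_def prod_nonneg stochastic_def)
  qed
  ultimately show ?thesis unfolding noisy_version_def by blast
qed

lemma measurable_gliders: "gliders \<in> borel \<rightarrow>\<^sub>M borel"
proof (rule measurable_coordinatewise_then_product)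
  fix k
  define h where "h a b c = gliders (\<lambda>j. if j < k then a else if j = k then b else c) k" for a b c
  have coord: "(\<lambda>x::conf. x j) \<in> borel \<rightarrow>\<^sub>M count_space UNIV" for j
    using measurable_coordinate[of "\<lambda>x. x"] by simp
  have "(\<lambda>x. h a b (x (k + 1))) \<in> borel \<rightarrow>\<^sub>M count_space UNIV" for a b
    using coord by (rule measurable_compose) simp
  then have "(\<lambda>x. h a (x k) (x (k + 1))) \<in> borel \<rightarrow>\<^sub>M count_space UNIV" for a
    using coord by (rule measurable_compose_countable)
  then have "(\<lambda>x. h (x (k - 1)) (x k) (x (k + 1))) \<in> borel \<rightarrow>\<^sub>M count_space UNIV"
    using coord by (rule measurable_compose_countable)
  moreover have "gliders x k = h (x (k - 1)) (x k) (x (k + 1))" for x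
    by (simp add: h_def gliders_def reflect_def glide_def cong: comp.case_cong)
  ultimately show "(\<lambda>x. gliders x k) \<in> borel \<rightarrow>\<^sub>M borel"
    by (simp add: measurable_cong_sets[OF refl sets_cell] del: measurable_count_space_eq1)
qed

text \<open>In particular the hypotheses of the theorem are satisfiable for all positive rates.\<close>

lemma noisy_gliders_exist:
  "positive_rates \<beta> \<delta> \<Longrightarrow> \<exists>\<Phi>. noisy_version gliders (birth_death \<beta> \<delta>) \<Phi>"
  by (intro noisy_version_exists measurable_gliders stochastic_birth_death)

end

(* A reflecting wall merely interchanges the two kinds of particles, so every component of a cell at
   time s + 1 is a noisy copy of one component at time s. Traced backwards, the ancestry of a wall stays
   at its site and the ancestry of a particle is a single path steered by the walls. Each step of
   noise forgets the ancestor with a probability that is bounded below (namely when the uniform sample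
   does not separate the two thresholds 1 - \<delta> and \<beta>), so the walls around a site, and then the path
   of a particle, are almost surely determined by finitely many rows of noise. Coupling from the past
   thus yields a random configuration whose law attracts all trajectories uniformly, with an error that
   is uniform in space. Over n steps, distant patterns are independent, which gives mixing. The
   sampler runs the three-valued simulation (absent, present, unknown) with the same noise from ever
   earlier times in growing windows until the pattern is known. *)
theory Submission
  imports Defs
begin

section \<open>Independent uniform samples\<close>

text \<open>The obstacle is that the path of a particle is steered by random walls which must
  themselves be determined first, so the samples met along the path are not chosen independently of
  the noise. Two facts remove it: the history of a wall reads only wall samples, and particles read
  samples with other indices. One can therefore fix an event that is decided by wall samples alone
  and makes every wall within reach of the path known. On it the particle meets a fresh sample in
  each row and stays unknown with a factor \<open>rate\<close> per row. Splitting by the wall at the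
  present site partitions the event, so no branching factor arises. The price is a union bound over
  the \<open>m * (2 * m + 1)\<close> walls in the box reached in \<open>m\<close> steps, each with
  at least \<open>m\<close> further rows to become known: hence the depth \<open>2 * m\<close> and
  the polynomial factor in \<open>gap\<close>. Numbering rows by their distance from the present
  ties each sample to a point of space-time whatever the starting time. Deeper runs thus refine
  shallower ones, and stopping at the first success introduces no bias.\<close>

abbreviation unif :: "real measure" where
  "unif \<equiv> uniform_measure lborel {0..1}"

lemma prob_space_unif: "prob_space unif"
  by (rule prob_space_uniform_measure) auto

interpretation unif: product_prob_space "\<lambda>_::nat. unif" UNIV
  by (intro product_prob_spaceI prob_space_unif)

interpretation samples: prob_space uniform_samples
  unfolding uniform_samples_def by (rule prob_space_PiM) (rule prob_space_unif)

lemma space_samples [simp]: "space uniform_samples = UNIV"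
  by (simp add: uniform_samples_def space_PiM)

lemma measurable_sample [measurable]: "(\<lambda>\<omega>. \<omega> n) \<in> uniform_samples \<rightarrow>\<^sub>M borel"
proof -
  have "(\<lambda>\<omega>. \<omega> n) \<in> uniform_samples \<rightarrow>\<^sub>M unif"
    unfolding uniform_samples_def by measurable
  then show ?thesis by (simp cong: measurable_cong_sets)
qed

lemma pred_events: "Measurable.pred uniform_samples P \<Longrightarrow> {\<omega>. P \<omega>} \<in> samples.events"
  by (simp add: pred_def)

text \<open>A functional stand-in for measurability with respect to the coordinates in
  \<open>J\<close>. It can be checked by recursion on a run, and together with ordinary
  measurability it yields independence.\<close>

definition depends_on :: "'i set \<Rightarrow> (('i \<Rightarrow> 'a) \<Rightarrow> 'b) \<Rightarrow> bool" where
  "depends_on J f \<longleftrightarrow> (\<forall>\<omega> \<omega>'. (\<forall>j\<in>J. \<omega> j = \<omega>' j) \<longrightarrow> f \<omega> = f \<omega>')"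

lemma depends_onI:
  "(\<And>\<omega> \<omega>'. (\<And>j. j \<in> J \<Longrightarrow> \<omega> j = \<omega>' j) \<Longrightarrow> f \<omega> = f \<omega>') \<Longrightarrow> depends_on J f"
  unfolding depends_on_def by metis

lemma depends_onD:
  "depends_on J f \<Longrightarrow> (\<And>j. j \<in> J \<Longrightarrow> \<omega> j = \<omega>' j) \<Longrightarrow> f \<omega> = f \<omega>'"
  unfolding depends_on_def by metis

lemma depends_on_mono: "depends_on J f \<Longrightarrow> J \<subseteq> J' \<Longrightarrow> depends_on J' f"
  unfolding depends_on_def by (meson subsetD)

lemma depends_on_const: "depends_on J (\<lambda>\<omega>. c)"
  by (simp add: depends_on_def)

lemma depends_on_comp2:
  "depends_on J f \<Longrightarrow> depends_on J g \<Longrightarrow> depends_on J (\<lambda>\<omega>. h (f \<omega>) (g \<omega>))"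
  unfolding depends_on_def by metis

lemma depends_on_comp: "depends_on J f \<Longrightarrow> depends_on J (\<lambda>\<omega>. h (f \<omega>))"
  unfolding depends_on_def by metis

lemma depends_on_ex:
  fixes P :: "'w \<Rightarrow> ('i \<Rightarrow> 'a) \<Rightarrow> bool"
  assumes "\<And>w. depends_on J (P w)"
  shows "depends_on J (\<lambda>\<omega>. \<exists>w. P w \<omega>)"
proof (rule depends_onI)
  fix \<omega> \<omega>' :: "'i \<Rightarrow> 'a"
  assume "\<And>j. j \<in> J \<Longrightarrow> \<omega> j = \<omega>' j"
  then have "P w \<omega> = P w \<omega>'" for w by (intro depends_onD[OF assms])
  then show "(\<exists>w. P w \<omega>) = (\<exists>w. P w \<omega>')" by simp
qed

lemma prob_conj_depends_on:
  assumes P: "depends_on I P" "Measurable.pred uniform_samples P"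
    and Q: "depends_on J Q" "Measurable.pred uniform_samples Q"
    and disj: "I \<inter> J = {}"
  shows "samples.prob {\<omega>. P \<omega> \<and> Q \<omega>} = samples.prob {\<omega>. P \<omega>} * samples.prob {\<omega>. Q \<omega>}"
proof -
  have iv: "samples.indep_vars (\<lambda>_. unif) (\<lambda>n \<omega>. \<omega> n) UNIV"
  proof (subst samples.indep_vars_iff_distr_eq_PiM')
    show "distr uniform_samples (\<Pi>\<^sub>M i\<in>UNIV. unif) (\<lambda>x. \<lambda>i\<in>UNIV. x i) =
        (\<Pi>\<^sub>M i\<in>UNIV. distr uniform_samples unif (\<lambda>\<omega>. \<omega> i))"
      proof -
      have "distr uniform_samples unif (\<lambda>\<omega>. \<omega> i) = unif" for i
        unfolding uniform_samples_def by (rule unif.PiM_component) simp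
      moreover have "(\<lambda>x. \<lambda>i\<in>UNIV. x i) = (\<lambda>x :: nat \<Rightarrow> real. x)" by (simp add: fun_eq_iff)
      ultimately show ?thesis by (simp add: uniform_samples_def distr_id2)
    qed
  qed (auto simp: uniform_samples_def)
  have iv2: "samples.indep_var (\<Pi>\<^sub>M i\<in>I. unif) (\<lambda>\<omega>. restrict (\<lambda>i. \<omega> i) I)
      (\<Pi>\<^sub>M i\<in>J. unif) (\<lambda>\<omega>. restrict (\<lambda>i. \<omega> i) J)"
    by (rule samples.indep_var_restrict[OF iv disj]) auto
  \<comment> \<open>Filling the coordinates outside \<open>H\<close> with \<open>0\<close> turns a
    predicate on all samples into one on \<open>H\<close> alone. This stays measurable, and by
    \<open>depends_on\<close> it is the original predicate.\<close>
  define ext where "ext H f = (\<lambda>n. if n \<in> H then f n else (0::real))" for H :: "nat set" and f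
  have ext: "ext H \<in> (\<Pi>\<^sub>M i\<in>H. unif) \<rightarrow>\<^sub>M uniform_samples" for H
    unfolding uniform_samples_def
  proof (rule measurable_PiM_single')
    fix i :: nat
    show "(\<lambda>f. ext H f i) \<in> (\<Pi>\<^sub>M i\<in>H. unif) \<rightarrow>\<^sub>M unif"
      by (cases "i \<in> H") (auto simp: ext_def)
  qed (auto simp: space_PiM)
  have sets: "{f \<in> space (\<Pi>\<^sub>M i\<in>H. unif). T (ext H f)} \<in> sets (\<Pi>\<^sub>M i\<in>H. unif)"
    if "Measurable.pred uniform_samples T" for H T
    using measurable_sets[OF measurable_compose[OF ext that], of "{True}" H]
    by (simp add: vimage_def Int_def conj_commute)
  have cyl: "T (ext H (restrict \<omega> H)) = T \<omega>" if "depends_on H T" for H T and \<omega> :: "nat \<Rightarrow> real"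
    by (rule depends_onD[OF that]) (simp add: ext_def)
  let ?A = "{f \<in> space (\<Pi>\<^sub>M i\<in>I. unif). P (ext I f)}"
  let ?B = "{f \<in> space (\<Pi>\<^sub>M i\<in>J. unif). Q (ext J f)}"
  have A: "(\<lambda>\<omega>. restrict \<omega> I) -` ?A = {\<omega>. P \<omega>}" and B: "(\<lambda>\<omega>. restrict \<omega> J) -` ?B = {\<omega>. Q \<omega>}"
    by (auto simp: space_PiM cyl[OF P(1)] cyl[OF Q(1)])
  have "(\<lambda>\<omega>. (restrict \<omega> I, restrict \<omega> J)) -` (?A \<times> ?B) = {\<omega>. P \<omega> \<and> Q \<omega>}"
    using A B by auto
  with samples.indep_varD[OF iv2 sets[OF P(2)] sets[OF Q(2)]] A B show ?thesis by simp
qed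

lemma prob_sample_less:
  assumes "0 \<le> c" "c \<le> 1"
  shows "samples.prob {\<omega>. \<omega> n < c} = c"
proof -
  have "samples.prob {\<omega>. \<omega> n < c} = measure unif {x. x < c}"
    using unif.emeasure_PiM_Collect_single[of n "{x. x < c}"]
    by (simp add: uniform_samples_def[symmetric] measure_def)
  also have "\<dots> = measure lborel {0..<c}"
  proof -
    have "{0..1} \<inter> {x. x < c} = {0..<c}" using assms by auto
    then show ?thesis by (subst measure_uniform_measure) auto
  qed
  also have "\<dots> = c" using assms by simp
  finally show ?thesis .
qed

lemma prob_Ball_depends_on:
  fixes E :: "'a \<Rightarrow> (nat \<Rightarrow> real) \<Rightarrow> bool"
  assumes "finite A" and "\<And>a. a \<in> A \<Longrightarrow> depends_on (H a) (E a)"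
    and "\<And>a. a \<in> A \<Longrightarrow> Measurable.pred uniform_samples (E a)"
    and "disjoint_family_on H A"
  shows "samples.prob {\<omega>. \<forall>a\<in>A. E a \<omega>} = (\<Prod>a\<in>A. samples.prob {\<omega>. E a \<omega>})"
  using assms
proof (induction A)
  case empty
  then show ?case using samples.prob_space by simp
next
  case (insert a A)
  have dep: "depends_on (\<Union>a\<in>A. H a) (\<lambda>\<omega>. \<forall>a\<in>A. E a \<omega>)"
    using insert.prems(1) unfolding depends_on_def by (metis UN_iff insertI2)
  have "H a \<inter> H b = {}" if "b \<in> A" for b
    using insert.prems(3) insert.hyps(2) that by (intro disjoint_family_onD[OF insert.prems(3)]) auto
  then have disj: "H a \<inter> (\<Union>a\<in>A. H a) = {}"
    by (simp add: Int_UN_distrib)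
  have meas: "Measurable.pred uniform_samples (\<lambda>\<omega>. \<forall>a\<in>A. E a \<omega>)"
    using insert.hyps insert.prems(2) by (intro pred_intros_finite) auto
  have "samples.prob {\<omega>. E a \<omega> \<and> (\<forall>a\<in>A. E a \<omega>)} =
      samples.prob {\<omega>. E a \<omega>} * samples.prob {\<omega>. \<forall>a\<in>A. E a \<omega>}"
    by (rule prob_conj_depends_on[OF insert.prems(1,2) dep meas disj]) auto
  also have "samples.prob {\<omega>. \<forall>a\<in>A. E a \<omega>} = (\<Prod>a\<in>A. samples.prob {\<omega>. E a \<omega>})"
    using insert.prems by (intro insert.IH) (auto simp: disjoint_family_on_def)
  finally show ?case
    using insert.hyps by simp
qed

section \<open>The space-time noise\<close>

text \<open>With \<open>K = t + k\<^sup>2\<close> one has \<open>-K \<le> k \<le> K\<close>, so that \<open>K\<close> and \<open>k\<close> are recovered from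
  \<open>K\<^sup>2 + K + k \<in> {K\<^sup>2..<(K + 1)\<^sup>2}\<close>. This pairing is a polynomial, so it is a single expression of
  the programming language.\<close>

definition site_code :: "nat \<Rightarrow> int \<Rightarrow> int" where
  "site_code t k = (int t + k * k) * (int t + k * k) + (int t + k * k) + k"

lemma site_code_bounds:
  fixes t :: nat and k :: int
  defines "K \<equiv> int t + k * k"
  shows "K * K \<le> site_code t k" "site_code t k < (K + 1) * (K + 1)"
proof -
  have "\<bar>k\<bar> \<le> k * k"
    using mult_left_mono[of 1 "\<bar>k\<bar>" "\<bar>k\<bar>"] by (cases "k = 0") (auto simp: abs_mult_self_eq)
  then have "\<bar>k\<bar> \<le> K" by (simp add: K_def)
  then show "K * K \<le> site_code t k" "site_code t k < (K + 1) * (K + 1)"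
    unfolding site_code_def K_def by (auto simp: algebra_simps)
qed

lemma site_code_nonneg: "0 \<le> site_code t k"
  using site_code_bounds(1)[of t k] by (meson order_trans zero_le_square)

lemma site_code_eq_iff: "site_code t k = site_code s j \<longleftrightarrow> t = s \<and> k = j"
proof
  assume eq: "site_code t k = site_code s j"
  define K where "K = int t + k * k"
  define J where "J = int s + j * j"
  have "0 \<le> K" "0 \<le> J" by (simp_all add: K_def J_def)
  have "K * K < (J + 1) * (J + 1)" "J * J < (K + 1) * (K + 1)"
    using site_code_bounds[of t k] site_code_bounds[of s j] eq unfolding K_def J_def by linarith+
  then have "K < J + 1" "J < K + 1"
    using \<open>0 \<le> K\<close> \<open>0 \<le> J\<close> by (meson add_nonneg_nonneg linorder_not_less mult_mono zero_le_one)+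
  then have KJ: "K = J" by simp
  then have "k = j"
    using eq unfolding site_code_def K_def[symmetric] J_def[symmetric] by simp
  with KJ show "t = s \<and> k = j" by (simp add: K_def J_def)
qed auto

definition comp_index :: "comp \<Rightarrow> nat" where
  "comp_index i = (case i of W \<Rightarrow> 0 | R \<Rightarrow> 1 | L \<Rightarrow> 2)"

text \<open>The component is the residue modulo 3, so the samples of a site are consecutive and can
  be drawn as one triple.\<close>

definition noise_index :: "nat \<Rightarrow> int \<Rightarrow> comp \<Rightarrow> nat" where
  "noise_index t k i = 3 * nat (site_code t k) + comp_index i"

lemma noise_index_eq_iff:
  "noise_index t k i = noise_index s j c \<longleftrightarrow> t = s \<and> k = j \<and> i = c"
proof
  assume eq: "noise_index t k i = noise_index s j c"
  have "comp_index i < 3" "comp_index c < 3"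
    by (simp_all add: comp_index_def split: comp.splits)
  moreover have "m = n \<and> a = b" if "3 * m + a = 3 * n + b" "a < 3" "b < 3" for m n a b :: nat
    using that by presburger
  ultimately have "nat (site_code t k) = nat (site_code s j)" and i: "comp_index i = comp_index c"
    using eq unfolding noise_index_def by blast+
  then have "site_code t k = site_code s j"
    using site_code_nonneg nat_eq_iff2 by (metis eq_nat_nat_iff)
  moreover have "i = c" using i by (simp add: comp_index_def split: comp.splits)
  ultimately show "t = s \<and> k = j \<and> i = c" by (simp add: site_code_eq_iff)
qed auto

section \<open>Coupled trajectories\<close>

text \<open>At a wall, reflection interchanges the two kinds of particles (also when both or none are
  present). So every component has a single parent component, selected by the wall.\<close>

lemma gliders_simps:
  "gliders x k W = x k W"
  "gliders x k R = (if x k W then x (k + 1) L else x (k - 1) R)"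
  "gliders x k L = (if x k W then x (k - 1) R else x (k + 1) L)"
proof -
  have cell: "f = cell w r l \<longleftrightarrow> (f W = w \<and> f R = r \<and> f L = l)" for f w r l
    by (auto simp: cell_def fun_eq_iff split: comp.split)
  have cells: "cell w r l W = w" "cell w r l R = r" "cell w r l L = l" for w r l
    by (simp_all add: cell_def)
  show "gliders x k W = x k W"
    "gliders x k R = (if x k W then x (k + 1) L else x (k - 1) R)"
    "gliders x k L = (if x k W then x (k - 1) R else x (k + 1) L)"
    unfolding gliders_def reflect_def glide_def comp_def cell by (auto simp: cells)
qed

locale birth_death_noise =
  fixes \<beta> \<delta> :: "comp \<Rightarrow> real"
  assumes positive: "positive_rates \<beta> \<delta>"
begin

abbreviation \<theta> :: "cell \<Rightarrow> cell \<Rightarrow> real" where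
  "\<theta> \<equiv> birth_death \<beta> \<delta>"

text \<open>The chance that a component is present after the noise if its value before was
  \<open>a\<close>. Comparing one uniform sample with both thresholds is what couples the two rows
  of the matrix.\<close>

definition thr :: "comp \<Rightarrow> bool \<Rightarrow> real" where
  "thr i a = birth_death1 (\<beta> i) (\<delta> i) a True"

lemma thr: "0 < thr i a" "thr i a < 1"
  using positive by (auto simp: thr_def birth_death1_def positive_rates_def)

lemma birth_death1_thr: "birth_death1 (\<beta> i) (\<delta> i) a b = (if b then thr i a else 1 - thr i a)"
  by (simp add: thr_def birth_death1_def)

text \<open>Time runs backwards: row \<open>t\<close> of the noise produces the configuration at time \<open>-t\<close>.\<close>

primrec traj :: "(nat \<Rightarrow> real) \<Rightarrow> conf \<Rightarrow> nat \<Rightarrow> nat \<Rightarrow> conf" where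
  "traj \<omega> x 0 t = x"
| "traj \<omega> x (Suc n) t = (\<lambda>k i. \<omega> (noise_index t k i) < thr i (gliders (traj \<omega> x n (Suc t)) k i))"

text \<open>A three-valued reading of \<open>gliders\<close> that is deliberately cautious: at an
  unknown wall the particle is unknown even if both candidate parents agree. So a known wall leaves
  exactly one candidate to follow, and an unknown one leaves none.\<close>

definition parent :: "(int \<Rightarrow> comp \<Rightarrow> bool option) \<Rightarrow> int \<Rightarrow> comp \<Rightarrow> bool option" where
  "parent q k i = (case i of W \<Rightarrow> q k W
     | R \<Rightarrow> (case q k W of None \<Rightarrow> None | Some w \<Rightarrow> if w then q (k + 1) L else q (k - 1) R)
     | L \<Rightarrow> (case q k W of None \<Rightarrow> None | Some w \<Rightarrow> if w then q (k - 1) R else q (k + 1) L))"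

lemma parent_mono:
  assumes "parent q k i = Some a" and q: "\<And>j c b. q j c = Some b \<Longrightarrow> q' j c = Some b"
  shows "parent q' k i = Some a"
proof -
  obtain w where w: "q k W = Some w"
    using assms(1) by (cases i; cases "q k W") (auto simp: parent_def)
  from q[OF this] have "q' k W = Some w" .
  with assms w show ?thesis by (cases i; cases w) (auto simp: parent_def)
qed

lemma parent_cong:
  "(\<And>j c. \<bar>j - k\<bar> \<le> 1 \<Longrightarrow> q j c = q' j c) \<Longrightarrow> parent q k i = parent q' k i"
  by (cases i) (simp_all add: parent_def split: option.split)

definition noisy :: "comp \<Rightarrow> real \<Rightarrow> bool option \<Rightarrow> bool option" where
  "noisy i u v = (case v of Some a \<Rightarrow> Some (u < thr i a)
     | None \<Rightarrow> if (u < thr i False) = (u < thr i True) then Some (u < thr i True) else None)"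

text \<open>What the noise of the \<open>n\<close> rows \<open>t, \<dots>, t + n - 1\<close> at the sites in \<open>S\<close> tells about the
  configuration at time \<open>-t\<close> without any information on the configuration at time \<open>-(t + n)\<close>.\<close>

primrec known :: "(nat \<Rightarrow> real) \<Rightarrow> int set \<Rightarrow> nat \<Rightarrow> nat \<Rightarrow> int \<Rightarrow> comp \<Rightarrow> bool option" where
  "known \<omega> S 0 t = (\<lambda>k i. None)"
| "known \<omega> S (Suc n) t = (\<lambda>k i. if k \<in> S
     then noisy i (\<omega> (noise_index t k i)) (parent (known \<omega> S n (Suc t)) k i) else None)"

text \<open>Soundness of the three-valued run. As \<open>x\<close> is arbitrary, a known component
  is one at which all trajectories started \<open>n\<close> rows earlier have coalesced.\<close>

lemma known_imp_traj: "known \<omega> S n t k i = Some b \<Longrightarrow> traj \<omega> x n t k i = b"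
proof (induction n arbitrary: t k i b)
  case (Suc n)
  have "gliders (traj \<omega> x n (Suc t)) k i = a" if "parent (known \<omega> S n (Suc t)) k i = Some a" for a
    using that Suc.IH[of "Suc t"]
    by (cases i) (auto simp: parent_def gliders_simps split: option.splits if_splits)
  with Suc.prems show ?case
    by (cases "gliders (traj \<omega> x n (Suc t)) k i")
      (auto simp: noisy_def split: if_splits option.splits)
qed simp

lemma noisy_mono: "noisy i u v = Some b \<Longrightarrow> (\<And>a. v = Some a \<Longrightarrow> v' = Some a) \<Longrightarrow> noisy i u v' = Some b"
  by (cases v; cases v'; cases "the v'") (auto simp: noisy_def split: if_splits)

text \<open>The bottom row carries no information at all, and every rule is monotone in information.
  Starting earlier or widening the window can therefore only add values, never change them.\<close>

lemma known_mono:
  "known \<omega> S n t k i = Some b \<Longrightarrow> n \<le> m \<Longrightarrow> S \<subseteq> S' \<Longrightarrow> known \<omega> S' m t k i = Some b"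
proof (induction n arbitrary: m t k i b)
  case (Suc n)
  then obtain m' where m: "m = Suc m'" "n \<le> m'" by (cases m) auto
  have "parent (known \<omega> S' m' (Suc t)) k i = Some a"
    if "parent (known \<omega> S n (Suc t)) k i = Some a" for a
    using that by (rule parent_mono) (rule Suc.IH[OF _ m(2) Suc.prems(3)])
  then show ?case
    using Suc.prems by (auto simp: m split: if_splits intro: noisy_mono)
qed simp

text \<open>Information moves at most one site per row, so nothing outside this interval is
  consulted. This later allows the sampler to work in finite windows.\<close>

lemma known_restrict:
  "{k - int n..k + int n} \<subseteq> S \<Longrightarrow> known \<omega> S n t k i = known \<omega> UNIV n t k i"
proof (induction n arbitrary: t k i)
  case (Suc n)
  have "known \<omega> S n (Suc t) j c = known \<omega> UNIV n (Suc t) j c" if "\<bar>j - k\<bar> \<le> 1" for j c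
  proof (rule Suc.IH)
    have "{j - int n..j + int n} \<subseteq> {k - int (Suc n)..k + int (Suc n)}" using that by auto
    then show "{j - int n..j + int n} \<subseteq> S" using Suc.prems by (rule order_trans)
  qed
  then have "parent (known \<omega> S n (Suc t)) k i = parent (known \<omega> UNIV n (Suc t)) k i"
    by (rule parent_cong)
  moreover have "k \<in> S" using Suc.prems by auto
  ultimately show ?case by simp
qed simp

lemma known_Some_unique:
  assumes "known \<omega> S n t k i = Some b" "known \<omega> S' n' t k i = Some b'"
  shows "b = b'"
  using known_mono[OF assms(1), of "max n n'" UNIV] known_mono[OF assms(2), of "max n n'" UNIV]
  by simp

section \<open>Which samples a run depends on\<close>

definition cone :: "nat \<Rightarrow> nat \<Rightarrow> int \<Rightarrow> nat set" where
  "cone n t k = {noise_index s j c | s j c. t \<le> s \<and> \<bar>j - k\<bar> \<le> int n}"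

lemma cone_step: "\<bar>j - k\<bar> \<le> 1 \<Longrightarrow> cone n (Suc t) j \<subseteq> cone (Suc n) t k"
  unfolding cone_def by force

lemma noise_index_in_cone: "noise_index t k i \<in> cone n t k"
  unfolding cone_def by force

lemma gliders_cong:
  "(\<And>j. \<bar>j - k\<bar> \<le> 1 \<Longrightarrow> x j = y j) \<Longrightarrow> gliders x k = gliders y k"
  by (rule ext, rename_tac i, case_tac i) (simp_all add: gliders_simps)

text \<open>\<open>cone\<close> is a coarse form of the light cone, of constant width and unbounded
  depth. It still separates a run from row \<open>t - 1\<close> in time and from distant runs in
  space, which are the two uses made of it.\<close>

lemma depends_on_traj: "depends_on (cone n t k) (\<lambda>\<omega>. traj \<omega> x n t k)"
proof (induction n arbitrary: t k)
  case (Suc n)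
  show ?case
  proof (rule depends_onI)
    fix \<omega> \<omega>' :: "nat \<Rightarrow> real"
    assume eq: "\<omega> j = \<omega>' j" if "j \<in> cone (Suc n) t k" for j
    have "traj \<omega> x n (Suc t) j = traj \<omega>' x n (Suc t) j" if "\<bar>j - k\<bar> \<le> 1" for j
      using cone_step[OF that] by (intro depends_onD[OF Suc.IH] eq) auto
    then have "gliders (traj \<omega> x n (Suc t)) k = gliders (traj \<omega>' x n (Suc t)) k"
      by (rule gliders_cong)
    then show "traj \<omega> x (Suc n) t k = traj \<omega>' x (Suc n) t k"
      using eq[OF noise_index_in_cone] by (simp add: fun_eq_iff)
  qed
qed (simp add: depends_on_const)

lemma depends_on_known:
  "depends_on {noise_index s j c | s j c. t \<le> s} (\<lambda>\<omega>. known \<omega> S n t k i)"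
proof (induction n arbitrary: t k i)
  case (Suc n)
  show ?case
  proof (rule depends_onI)
    fix \<omega> \<omega>' :: "nat \<Rightarrow> real"
    assume eq: "\<omega> j = \<omega>' j" if "j \<in> {noise_index s j c | s j c. t \<le> s}" for j
    have "known \<omega> S n (Suc t) j c = known \<omega>' S n (Suc t) j c" for j c
      by (rule depends_onD[OF Suc.IH]) (auto intro!: eq dest: Suc_leD)
    then have "parent (known \<omega> S n (Suc t)) k i = parent (known \<omega>' S n (Suc t)) k i"
      by (rule parent_cong)
    moreover have "\<omega> (noise_index t k i) = \<omega>' (noise_index t k i)" by (rule eq) auto
    ultimately show "known \<omega> S (Suc n) t k i = known \<omega>' S (Suc n) t k i"
      by simp
  qed
qed (simp add: depends_on_const)

text \<open>The parent of a wall is the wall at the same site, so its history never consults a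
  particle. This is what permits fixing the walls without touching the particle samples.\<close>

lemma depends_on_known_wall:
  "depends_on {noise_index s k W | s. t \<le> s} (\<lambda>\<omega>. known \<omega> S n t k W)"
proof (induction n arbitrary: t)
  case (Suc n)
  show ?case
  proof (rule depends_onI)
    fix \<omega> \<omega>' :: "nat \<Rightarrow> real"
    assume eq: "\<omega> j = \<omega>' j" if "j \<in> {noise_index s k W | s. t \<le> s}" for j
    have "known \<omega> S n (Suc t) k W = known \<omega>' S n (Suc t) k W"
      by (rule depends_onD[OF Suc.IH]) (auto intro!: eq dest: Suc_leD)
    moreover have "\<omega> (noise_index t k W) = \<omega>' (noise_index t k W)" by (rule eq) auto
    ultimately show "known \<omega> S (Suc n) t k W = known \<omega>' S (Suc n) t k W"
      by (simp add: parent_def)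
  qed
qed (simp add: depends_on_const)

section \<open>Measurability of trajectories and of the three-valued run\<close>

lemma measurable_traj [measurable]:
  "Measurable.pred uniform_samples (\<lambda>\<omega>. traj \<omega> x n t k i)"
proof (induction n arbitrary: t k i)
  case (Suc n)
  note [measurable] = Suc.IH
  have [measurable]: "Measurable.pred uniform_samples (\<lambda>\<omega>. gliders (traj \<omega> x n (Suc t)) k i)"
    by (cases i) (simp_all add: gliders_simps)
  have "traj \<omega> x (Suc n) t k i \<longleftrightarrow> (if gliders (traj \<omega> x n (Suc t)) k i
      then \<omega> (noise_index t k i) < thr i True else \<omega> (noise_index t k i) < thr i False)" for \<omega>
    by simp
  then show ?case by simp
qed simp

lemma measurable_known_eq [measurable]:
  "Measurable.pred uniform_samples (\<lambda>\<omega>. known \<omega> S n t k i = v)"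
proof (induction n arbitrary: t k i v)
  case (Suc n)
  note [measurable] = Suc.IH
  have [measurable]: "Measurable.pred uniform_samples (\<lambda>\<omega>. parent (known \<omega> S n (Suc t)) k i = a)" for a
  proof -
    \<comment> \<open>The site that is read depends on a random wall. Splitting by the value of the
      wall leaves events with fixed sites.\<close>
    have "parent q k i = a \<longleftrightarrow> (case i of W \<Rightarrow> q k W = a
      | R \<Rightarrow> (q k W = None \<and> a = None) \<or> (q k W = Some True \<and> q (k + 1) L = a)
          \<or> (q k W = Some False \<and> q (k - 1) R = a)
      | L \<Rightarrow> (q k W = None \<and> a = None) \<or> (q k W = Some True \<and> q (k - 1) R = a)
          \<or> (q k W = Some False \<and> q (k + 1) L = a))" for q
      by (auto simp: parent_def split: comp.splits option.splits)
    then show ?thesis by (cases i) simp_all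
  qed
  let ?u = "\<lambda>\<omega>. \<omega> (noise_index t k i)" and ?p = "\<lambda>\<omega>. parent (known \<omega> S n (Suc t)) k i"
  have noisy: "noisy i u p = v \<longleftrightarrow>
      (p = Some True \<and> v = Some True \<and> u < thr i True) \<or>
      (p = Some True \<and> v = Some False \<and> \<not> u < thr i True) \<or>
      (p = Some False \<and> v = Some True \<and> u < thr i False) \<or>
      (p = Some False \<and> v = Some False \<and> \<not> u < thr i False) \<or>
      (p = None \<and> v = Some True \<and> u < thr i False \<and> u < thr i True) \<or>
      (p = None \<and> v = Some False \<and> \<not> u < thr i False \<and> \<not> u < thr i True) \<or>
      (p = None \<and> v = None \<and> (u < thr i False) \<noteq> (u < thr i True))" for u p
    by (cases p; cases "the p") (auto simp: noisy_def)
  show ?case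
  proof (cases "k \<in> S")
    case True
    then have eq: "(\<lambda>\<omega>. known \<omega> S (Suc n) t k i = v) = (\<lambda>\<omega>. noisy i (?u \<omega>) (?p \<omega>) = v)"
      by simp
    show ?thesis unfolding eq noisy by measurable
  next
    case False
    then have "(\<lambda>\<omega>. known \<omega> S (Suc n) t k i = v) = (\<lambda>\<omega>. None = v)"
      by simp
    then show ?thesis by (simp only: measurable_const space_count_space UNIV_I)
  qed
qed simp

section \<open>The probability of being unknown\<close>

text \<open>This includes flips: if \<open>thr i True < thr i False\<close>, a sample in between
  negates the parent. The point is that exactly these samples let the parent matter.\<close>

definition copies :: "comp \<Rightarrow> real \<Rightarrow> bool" where
  "copies i u \<longleftrightarrow> (u < thr i False) \<noteq> (u < thr i True)"

lemma measurable_copies [measurable]: "Measurable.pred uniform_samples (\<lambda>\<omega>. copies i (\<omega> n))"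
  unfolding copies_def by measurable

lemma noisy_None_iff: "noisy i u v = None \<longleftrightarrow> v = None \<and> copies i u"
  by (simp add: noisy_def copies_def split: option.split)

text \<open>\<open>thr i True - thr i False\<close> equals
  \<open>1 - \<delta> i - \<beta> i\<close>, the second eigenvalue of the matrix of component
  \<open>i\<close>; positivity of the rates keeps its absolute value below 1.\<close>

definition rate :: real where
  "rate = Max (range (\<lambda>i. \<bar>thr i True - thr i False\<bar>))"

lemma rate_ge: "\<bar>thr i True - thr i False\<bar> \<le> rate"
  unfolding rate_def by (intro Max_ge) auto

lemma rate: "0 \<le> rate" "rate < 1"
proof -
  show "0 \<le> rate" using rate_ge[of W] by linarith
  have "\<bar>thr i True - thr i False\<bar> < 1" for i
    using thr[of i True] thr[of i False] by linarith
  then show "rate < 1" unfolding rate_def by (subst Max_less_iff) auto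
qed

lemma prob_copies_le: "samples.prob {\<omega>. copies i (\<omega> n)} \<le> rate"
proof -
  define c d where "c = min (thr i False) (thr i True)" and "d = max (thr i False) (thr i True)"
  have cd: "0 \<le> c" "c \<le> d" "d \<le> 1" "d - c \<le> rate"
    using thr[of i False] thr[of i True] rate_ge[of i] by (auto simp: c_def d_def)
  have "{\<omega>. copies i (\<omega> n)} = {\<omega>. \<omega> n < d} - {\<omega>. \<omega> n < c}"
    by (auto simp: copies_def c_def d_def)
  moreover have "{\<omega>. \<omega> n < x} \<in> samples.events" for x
    using measurable_sample[THEN measurable_sets, of "{..<x}" n] by (simp add: vimage_def lessThan_def)
  ultimately have "samples.prob {\<omega>. copies i (\<omega> n)} = d - c"
    using cd by (simp add: samples.finite_measure_Diff prob_sample_less Collect_mono)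
  with cd show ?thesis by simp
qed

lemma prob_copies_conj_le:
  assumes "depends_on J P" "Measurable.pred uniform_samples P" "n \<notin> J"
  shows "samples.prob {\<omega>. copies i (\<omega> n) \<and> P \<omega>} \<le> rate * samples.prob {\<omega>. P \<omega>}"
proof -
  have "depends_on {n} (\<lambda>\<omega>. copies i (\<omega> n))" by (auto simp: depends_on_def)
  then have "samples.prob {\<omega>. copies i (\<omega> n) \<and> P \<omega>} =
      samples.prob {\<omega>. copies i (\<omega> n)} * samples.prob {\<omega>. P \<omega>}"
    using assms by (intro prob_conj_depends_on) auto
  then show ?thesis
    by (simp add: mult_right_mono prob_copies_le)
qed

text \<open>A wall is unknown exactly when all \<open>n\<close> samples in its column copy, and
  these samples are independent.\<close>

lemma prob_unknown_wall_le: "samples.prob {\<omega>. known \<omega> UNIV n t k W = None} \<le> rate ^ n"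
proof (induction n arbitrary: t)
  case (Suc n)
  have "known \<omega> UNIV (Suc n) t k W = None \<longleftrightarrow>
      copies W (\<omega> (noise_index t k W)) \<and> known \<omega> UNIV n (Suc t) k W = None" for \<omega>
    by (auto simp: noisy_None_iff parent_def)
  moreover have "samples.prob {\<omega>. copies W (\<omega> (noise_index t k W)) \<and> known \<omega> UNIV n (Suc t) k W = None}
      \<le> rate * samples.prob {\<omega>. known \<omega> UNIV n (Suc t) k W = None}"
    by (rule prob_copies_conj_le[OF depends_on_comp[OF depends_on_known_wall]])
      (auto simp: noise_index_eq_iff)
  ultimately show ?case
    using mult_left_mono[OF Suc.IH rate(1), of "Suc t"] by simp
qed (simp add: samples.prob_space[simplified])

definition walls :: "nat set" where
  "walls = {noise_index s j W | s j. True}"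

text \<open>Where the walls are known, the ancestry of a particle is a single path. The event \<open>E\<close> is decided
  by the walls; splitting it according to the wall met next decides on the next site of the path.\<close>

lemma prob_unknown_particle_le:
  assumes "depends_on walls E" "Measurable.pred uniform_samples E" "i \<noteq> W"
    and "\<And>\<omega> s j. E \<omega> \<Longrightarrow> s < m \<Longrightarrow> \<bar>j - k\<bar> \<le> int m \<Longrightarrow>
      known \<omega> UNIV (m + r - Suc s) (t + Suc s) j W \<noteq> None"
  shows "samples.prob {\<omega>. E \<omega> \<and> known \<omega> UNIV (m + r) t k i = None} \<le> rate ^ m * samples.prob {\<omega>. E \<omega>}"
  using assms
proof (induction m arbitrary: t k i E)
  case 0
  then show ?case by (simp, intro samples.finite_measure_mono pred_events) auto
next
  case (Suc m)
  note [measurable] = Suc.prems(2)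
  define wall where "wall \<omega> = known \<omega> UNIV (m + r) (Suc t) k W" for \<omega>
  have [measurable]: "Measurable.pred uniform_samples (\<lambda>\<omega>. wall \<omega> = v)" for v
    unfolding wall_def by measurable
  have wall: "wall \<omega> \<noteq> None" if "E \<omega>" for \<omega>
    using Suc.prems(4)[OF that, of 0 k] by (simp add: wall_def)
  \<comment> \<open>A right-mover at a wall and a left-mover away from one come from the right, the
    other two cases from the left. For \<open>i \<noteq> W\<close> this is the condition
    \<open>w \<longleftrightarrow> (i = R)\<close>.\<close>
  define q where "q \<omega> w = (let right = (w \<longleftrightarrow> (i = R)) in
      known \<omega> UNIV (m + r) (Suc t) (if right then k + 1 else k - 1) (if right then L else R))" for \<omega> w
  have parent: "parent (known \<omega> UNIV (m + r) (Suc t)) k i = q \<omega> w" if "wall \<omega> = Some w" for \<omega> w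
    using that \<open>i \<noteq> W\<close> by (cases i) (auto simp: parent_def wall_def q_def)
  define E' where "E' w \<omega> \<longleftrightarrow> E \<omega> \<and> wall \<omega> = Some w" for w \<omega>
  have meas [measurable]: "Measurable.pred uniform_samples (E' w)" for w
    unfolding E'_def by measurable
  have qmeas [measurable]: "Measurable.pred uniform_samples (\<lambda>\<omega>. q \<omega> w = v)" for w v
    unfolding q_def Let_def by measurable
  have dep_wall: "depends_on walls wall"
    unfolding wall_def by (rule depends_on_mono[OF depends_on_known_wall]) (auto simp: walls_def)
  have dep: "depends_on walls (E' w)" for w
    unfolding E'_def using Suc.prems(1) depends_on_comp[OF dep_wall] by (rule depends_on_comp2)
  have IH: "samples.prob {\<omega>. E' w \<omega> \<and> q \<omega> w = None} \<le> rate ^ m * samples.prob {\<omega>. E' w \<omega>}" for w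
    unfolding q_def Let_def
  proof (rule Suc.IH[OF dep meas])
    fix \<omega> s j
    assume "E' w \<omega>" "s < m" and j: "\<bar>j - (if w = (i = R) then k + 1 else k - 1)\<bar> \<le> int m"
    have "\<bar>j - k\<bar> \<le> int (Suc m)" using j by (auto split: if_splits)
    then show "known \<omega> UNIV (m + r - Suc s) (Suc t + Suc s) j W \<noteq> None"
      using Suc.prems(4)[of \<omega> "Suc s" j] \<open>E' w \<omega>\<close> \<open>s < m\<close> by (simp add: E'_def)
  qed auto
  \<comment> \<open>All wall samples, including those of row \<open>t\<close>, and everything from
    row \<open>Suc t\<close> on. The particle sample of row \<open>t\<close> lies in neither set, so
    it is fresh.\<close>
  let ?B = "walls \<union> {noise_index s j c | s j c. Suc t \<le> s}"
  have "samples.prob {\<omega>. E \<omega> \<and> known \<omega> UNIV (Suc m + r) t k i = None} \<le>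
      samples.prob {\<omega>. copies i (\<omega> (noise_index t k i)) \<and> (\<exists>w. E' w \<omega> \<and> q \<omega> w = None)}"
  proof (rule samples.finite_measure_mono)
    show "{\<omega>. E \<omega> \<and> known \<omega> UNIV (Suc m + r) t k i = None} \<subseteq>
      {\<omega>. copies i (\<omega> (noise_index t k i)) \<and> (\<exists>w. E' w \<omega> \<and> q \<omega> w = None)}"
      using wall parent by (fastforce simp: noisy_None_iff E'_def)
  qed (intro pred_events, measurable)
  also have "\<dots> \<le> rate * samples.prob {\<omega>. \<exists>w. E' w \<omega> \<and> q \<omega> w = None}"
  proof (rule prob_copies_conj_le)
    have "depends_on ?B (\<lambda>\<omega>. q \<omega> w)" for w
      unfolding q_def Let_def by (rule depends_on_mono[OF depends_on_known]) auto
    moreover have "depends_on ?B (E' w)" for w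
      by (rule depends_on_mono[OF dep]) simp
    ultimately show "depends_on ?B (\<lambda>\<omega>. \<exists>w. E' w \<omega> \<and> q \<omega> w = None)"
      by (intro depends_on_ex depends_on_comp2[where h = "\<lambda>a b. a \<and> b = None"])
    show "noise_index t k i \<notin> ?B"
      using \<open>i \<noteq> W\<close> by (auto simp: walls_def noise_index_eq_iff)
  qed measurable
  also have "samples.prob {\<omega>. \<exists>w. E' w \<omega> \<and> q \<omega> w = None} \<le> rate ^ m * samples.prob {\<omega>. E \<omega>}"
  proof -
    have ev: "{\<omega>. E' w \<omega> \<and> q \<omega> w = None} \<in> samples.events" "{\<omega>. E' w \<omega>} \<in> samples.events" for w
      by (intro pred_events, measurable)+
    have "{\<omega>. \<exists>w. E' w \<omega> \<and> q \<omega> w = None} =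
        {\<omega>. E' True \<omega> \<and> q \<omega> True = None} \<union> {\<omega>. E' False \<omega> \<and> q \<omega> False = None}"
      by (auto simp: ex_bool_eq)
    then have "samples.prob {\<omega>. \<exists>w. E' w \<omega> \<and> q \<omega> w = None} \<le>
        samples.prob {\<omega>. E' True \<omega> \<and> q \<omega> True = None} + samples.prob {\<omega>. E' False \<omega> \<and> q \<omega> False = None}"
      using measure_Un_le[OF ev(1)[of True] ev(1)[of False]] by simp
    also have "\<dots> \<le> rate ^ m * (samples.prob {\<omega>. E' True \<omega>} + samples.prob {\<omega>. E' False \<omega>})"
      using IH[of True] IH[of False] by (simp add: distrib_left)
    \<comment> \<open>The wall is known on \<open>E\<close>, so the two pieces partition
      \<open>E\<close> and their probabilities add up exactly. A crude bound by two branches would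
      cost a factor 2 per row and could destroy the decay.\<close>
    also have "samples.prob {\<omega>. E' True \<omega>} + samples.prob {\<omega>. E' False \<omega>} =
        samples.prob ({\<omega>. E' True \<omega>} \<union> {\<omega>. E' False \<omega>})"
      by (rule samples.finite_measure_Union[OF ev(2) ev(2), symmetric]) (auto simp: E'_def)
    also have "{\<omega>. E' True \<omega>} \<union> {\<omega>. E' False \<omega>} = {\<omega>. E \<omega>}"
      using wall by (auto simp: E'_def) (metis (full_types) option.exhaust)
    finally show ?thesis .
  qed
  finally show ?case using rate(1) by (simp add: mult_left_mono mult.assoc)
qed

text \<open>The first \<open>m\<close> steps of the path stay in a box of
  \<open>m * (2 * m + 1)\<close> walls, each with at least \<open>m\<close> rows behind it. Either
  one of these walls is unknown, which gives the second term, or the path meets \<open>m\<close>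
  copying samples, which gives the first.\<close>

lemma prob_unknown_le:
  "samples.prob {\<omega>. known \<omega> UNIV (2 * m) t k i = None} \<le> rate ^ m + real (m * (2 * m + 1)) * rate ^ m"
proof (cases "i = W")
  case True
  have "rate ^ (2 * m) \<le> rate ^ m"
    using rate by (intro power_decreasing) auto
  then have "samples.prob {\<omega>. known \<omega> UNIV (2 * m) t k i = None} \<le> rate ^ m"
    using prob_unknown_wall_le[of "2 * m" t k] True by simp
  moreover have "0 \<le> real (m * (2 * m + 1)) * rate ^ m" using rate by simp
  ultimately show ?thesis by linarith
next
  case False
  let ?S = "{..<m} \<times> {k - int m..k + int m}"
  let ?bad = "\<lambda>p. {\<omega>. known \<omega> UNIV (m + m - Suc (fst p)) (t + Suc (fst p)) (snd p) W = None}"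
  define E where "E \<omega> \<longleftrightarrow> (\<forall>p\<in>?S. known \<omega> UNIV (m + m - Suc (fst p)) (t + Suc (fst p)) (snd p) W \<noteq> None)" for \<omega>
  have evs: "{\<omega>. known \<omega> UNIV a b c d = v} \<in> samples.events" for a b c d v
    by (intro pred_events measurable_known_eq)
  have meas [measurable]: "Measurable.pred uniform_samples E"
    unfolding E_def by (intro pred_intros_finite pred_intros_logic measurable_known_eq) auto
  have dep: "depends_on walls E"
  proof (rule depends_onI)
    fix \<omega> \<omega>' :: "nat \<Rightarrow> real"
    assume eq: "\<omega> j = \<omega>' j" if "j \<in> walls" for j
    have "known \<omega> UNIV a b j W = known \<omega>' UNIV a b j W" for a b j
      by (rule depends_onD[OF depends_on_known_wall]) (rule eq, unfold walls_def, blast)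
    then show "E \<omega> = E \<omega>'" by (simp add: E_def)
  qed
  have "samples.prob {\<omega>. E \<omega> \<and> known \<omega> UNIV (m + m) t k i = None} \<le> rate ^ m * samples.prob {\<omega>. E \<omega>}"
    by (rule prob_unknown_particle_le[OF dep meas False]) (force simp: E_def)
  also have "\<dots> \<le> rate ^ m"
    using rate by (simp add: mult_left_le)
  finally have 1: "samples.prob {\<omega>. E \<omega> \<and> known \<omega> UNIV (m + m) t k i = None} \<le> rate ^ m" .
  have "samples.prob (\<Union>p\<in>?S. ?bad p) \<le> (\<Sum>p\<in>?S. samples.prob (?bad p))"
    by (intro samples.finite_measure_subadditive_finite) (auto intro: evs)
  also have "\<dots> \<le> (\<Sum>p\<in>?S. rate ^ m)"
  proof (rule sum_mono)
    fix p assume "p \<in> ?S"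
    then have "m \<le> m + m - Suc (fst p)" by auto
    then have "rate ^ (m + m - Suc (fst p)) \<le> rate ^ m"
      using rate by (intro power_decreasing) auto
    then show "samples.prob (?bad p) \<le> rate ^ m"
      using prob_unknown_wall_le order_trans by blast
  qed
  also have "\<dots> = real (m * (2 * m + 1)) * rate ^ m"
    by (simp add: card_cartesian_product nat_add_distrib nat_mult_distrib algebra_simps)
  finally have 2: "samples.prob (\<Union>p\<in>?S. ?bad p) \<le> real (m * (2 * m + 1)) * rate ^ m" .
  have evE: "{\<omega>. E \<omega> \<and> known \<omega> UNIV (m + m) t k i = None} \<in> samples.events"
    by (intro pred_events) measurable
  have "samples.prob {\<omega>. known \<omega> UNIV (2 * m) t k i = None} \<le>
      samples.prob ({\<omega>. E \<omega> \<and> known \<omega> UNIV (m + m) t k i = None} \<union> (\<Union>p\<in>?S. ?bad p))"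
  proof (rule samples.finite_measure_mono)
    show "{\<omega>. known \<omega> UNIV (2 * m) t k i = None} \<subseteq>
      {\<omega>. E \<omega> \<and> known \<omega> UNIV (m + m) t k i = None} \<union> (\<Union>p\<in>?S. ?bad p)"
      by (auto simp: E_def mult_2)
  qed (intro sets.Un evE sets.finite_UN evs finite_cartesian_product finite_lessThan finite_atLeastAtMost_int)
  also have "\<dots> \<le> samples.prob {\<omega>. E \<omega> \<and> known \<omega> UNIV (m + m) t k i = None} + samples.prob (\<Union>p\<in>?S. ?bad p)"
    by (intro measure_Un_le evE sets.finite_UN evs
        finite_cartesian_product finite_lessThan finite_atLeastAtMost_int)
  finally show ?thesis using 1 2 by linarith
qed

text \<open>The bound for the depth \<open>2 * m\<close> with \<open>m = n div 2\<close>, which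
  serves odd depths too because unknown components only become fewer with depth.\<close>

definition gap :: "nat \<Rightarrow> real" where
  "gap n = rate ^ (n div 2) + real ((n div 2) * (2 * (n div 2) + 1)) * rate ^ (n div 2)"

lemma prob_unknown_le_gap: "samples.prob {\<omega>. known \<omega> UNIV n t k i = None} \<le> gap n"
proof -
  have "samples.prob {\<omega>. known \<omega> UNIV n t k i = None} \<le>
      samples.prob {\<omega>. known \<omega> UNIV (2 * (n div 2)) t k i = None}"
  proof (rule samples.finite_measure_mono)
    show "{\<omega>. known \<omega> UNIV n t k i = None} \<subseteq> {\<omega>. known \<omega> UNIV (2 * (n div 2)) t k i = None}"
    proof safe
      fix \<omega> assume "known \<omega> UNIV n t k i = None"
      then show "known \<omega> UNIV (2 * (n div 2)) t k i = None"
        using known_mono[of \<omega> UNIV "2 * (n div 2)" t k i _ n UNIV]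
        by (cases "known \<omega> UNIV (2 * (n div 2)) t k i") auto
    qed
    show "{\<omega>. known \<omega> UNIV (2 * (n div 2)) t k i = None} \<in> samples.events"
      by (intro pred_events measurable_known_eq)
  qed
  also have "\<dots> \<le> gap n" unfolding gap_def by (rule prob_unknown_le)
  finally show ?thesis .
qed

lemma gap_tendsto_0: "gap \<longlonglongrightarrow> 0"
proof -
  define f where "f m = rate ^ m + real (m * (2 * m + 1)) * rate ^ m" for m
  have f_eq: "f = (\<lambda>m. rate ^ m + (2 * (real m ^ 2 * rate ^ m) + real m * rate ^ m))"
    by (simp add: f_def fun_eq_iff power2_eq_square algebra_simps)
  have r: "norm rate < 1" using rate by simp
  have lim0: "(\<lambda>m. rate ^ m) \<longlonglongrightarrow> 0" using r by (rule LIMSEQ_power_zero)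
  have lim1: "(\<lambda>m. real m * rate ^ m) \<longlonglongrightarrow> 0"
    using powser_times_n_limit_0[OF r] by simp
  have lim2: "(\<lambda>m. real m ^ 2 * rate ^ m) \<longlonglongrightarrow> 0"
  proof -
    \<comment> \<open>\<open>real m ^ 2 * rate ^ m\<close> is the square of
      \<open>real m * sqrt rate ^ m\<close>, which reduces the quadratic factor to a linear
      one.\<close>
    have "norm (sqrt rate) < 1" using rate by (simp add: real_sqrt_lt_1_iff)
    then have "(\<lambda>m. real m * sqrt rate ^ m) \<longlonglongrightarrow> 0"
      using powser_times_n_limit_0[of "sqrt rate"] by simp
    then have "(\<lambda>m. (real m * sqrt rate ^ m) ^ 2) \<longlonglongrightarrow> 0 ^ 2" by (rule tendsto_power)
    moreover have "(real m * sqrt rate ^ m) ^ 2 = real m ^ 2 * rate ^ m" for m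
      using rate by (simp add: power_mult_distrib power_mult[symmetric] mult.commute[of m 2])
        (simp add: power_mult)
    ultimately show ?thesis by simp
  qed
  have "f \<longlonglongrightarrow> 0 + (2 * 0 + 0)"
    unfolding f_eq by (intro tendsto_add tendsto_mult tendsto_const lim0 lim1 lim2)
  then have "f \<longlonglongrightarrow> 0" by simp
  moreover have "filterlim (\<lambda>n::nat. n div 2) sequentially sequentially"
    unfolding filterlim_at_top eventually_sequentially by (metis div_le_mono nonzero_mult_div_cancel_left zero_neq_numeral)
  ultimately have "(\<lambda>n. f (n div 2)) \<longlonglongrightarrow> 0" by (rule filterlim_compose)
  then show ?thesis by (simp add: f_def gap_def[abs_def])
qed

end

section \<open>Measures on configurations\<close>

lemma measurable_conf:
  assumes "\<And>k i. Measurable.pred M (\<lambda>\<omega>. f \<omega> k i)"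
  shows "f \<in> M \<rightarrow>\<^sub>M (borel :: conf measure)"
proof (intro measurable_coordinatewise_then_product)
  fix k i
  have "sets (borel :: bool measure) = sets (count_space UNIV)"
    by (auto intro!: borel_open simp: discrete_topology_class.open_discrete)
  then show "(\<lambda>\<omega>. f \<omega> k i) \<in> M \<rightarrow>\<^sub>M borel"
    using assms[of k i] measurable_cong_sets by blast
qed

lemma pred_conf [measurable]: "Measurable.pred borel (\<lambda>x::conf. x k i)"
  by (rule measurable_compose[OF measurable_coordinate[of "\<lambda>x. x"]]) auto

lemma cylinder_sets [measurable]:
  assumes "finite K"
  shows "cylinder K y \<in> sets borel"
proof -
  have "Measurable.pred borel (\<lambda>x::conf. x k = y k)" for k
    by (rule measurable_compose[OF measurable_coordinate[of "\<lambda>x. x"]]) auto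
  then have "Measurable.pred borel (\<lambda>x. \<forall>k\<in>K. x k = y k)"
    using assms by (intro pred_intros_finite)
  then show ?thesis by (simp add: cylinder_def pred_def)
qed

lemma measure_eqI_cylinder:
  assumes "prob_space M" "prob_space N" "sets M = sets borel" "sets N = sets borel"
    and eq: "\<And>K y. finite K \<Longrightarrow> measure M (cylinder K y) = measure N (cylinder K y)"
  shows "M = N"
proof -
  interpret M: prob_space M by fact
  interpret N: prob_space N by fact
  \<comment> \<open>Incompatible cylinders meet in the empty set, which is not a cylinder itself;
    adding it gives a generator stable under intersection.\<close>
  let ?E = "insert {} {cylinder K y | K y. finite K}"
  have gen: "sets (borel :: conf measure) = sigma_sets UNIV ?E"
  proof
    have "{x. x k \<in> B} \<in> sigma_sets UNIV ?E" for k :: int and B :: "cell set"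
    proof -
      have "(\<Union>b\<in>B. cylinder {k} (\<lambda>_. b)) \<in> sigma_sets UNIV ?E"
        by (intro sigma_sets_UNION countable_image countable_finite) (auto intro!: sigma_sets.Basic)
      also have "(\<Union>b\<in>B. cylinder {k} (\<lambda>_. b)) = {x. x k \<in> B}" by (auto simp: cylinder_def)
      finally show ?thesis .
    qed
    then show "sets (borel :: conf measure) \<subseteq> sigma_sets UNIV ?E"
      unfolding sets_conf[symmetric] sets_PiM_single
      by (simp add: PiE_UNIV_domain, intro sigma_sets_mono) auto
    show "sigma_sets UNIV ?E \<subseteq> sets (borel :: conf measure)"
    proof -
      have "?E \<subseteq> sets borel" using cylinder_sets by auto
      from sets.sigma_sets_subset[OF this] show ?thesis by simp
    qed
  qed
  have inter: "cylinder K y \<inter> cylinder J z \<in> ?E" if fin: "finite K" "finite J" for K J y z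
  proof (cases "cylinder K y \<inter> cylinder J z = {}")
    case False
    then obtain x where "x \<in> cylinder K y \<inter> cylinder J z" by blast
    then have "cylinder K y \<inter> cylinder J z = cylinder (K \<union> J) x"
      by (auto simp: cylinder_def)
    then show ?thesis using fin by auto
  qed simp
  show ?thesis
  proof (rule measure_eqI_generator_eq[where E = ?E and \<Omega> = UNIV and A = "\<lambda>_. UNIV"])
    show "Int_stable ?E"
    proof (rule Int_stableI)
      fix A B assume "A \<in> ?E" "B \<in> ?E"
      then show "A \<inter> B \<in> ?E"
      proof (cases "A = {} \<or> B = {}")
        case False
        with \<open>A \<in> ?E\<close> \<open>B \<in> ?E\<close> obtain K y J z
          where "A = cylinder K y" "B = cylinder J z" "finite K" "finite J" by blast
        then show ?thesis using inter by (simp only:)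
      qed auto
    qed
    show "emeasure M X = emeasure N X" if "X \<in> ?E" for X
    proof (cases "X = {}")
      case False
      with that obtain K y where "X = cylinder K y" "finite K" by blast
      then show ?thesis by (simp add: M.emeasure_eq_measure N.emeasure_eq_measure eq)
    qed simp
    have "UNIV = cylinder {} undefined" by (simp add: cylinder_def)
    then show "range (\<lambda>_. UNIV) \<subseteq> ?E" by blast
    show "sets M = sigma_sets UNIV ?E" "sets N = sigma_sets UNIV ?E"
      using assms(3,4) gen by (simp_all only:)
  qed simp_all
qed

text \<open>A function of finitely many cells is a finite combination of cylinder indicators.
  Replacing the integral by a finite sum later lets limits pass through a step of the
  kernel.\<close>

lemma integral_local:
  fixes f :: "conf \<Rightarrow> real"
  assumes "prob_space M" "sets M = sets borel" "finite K"
    and loc: "\<And>x y. (\<And>k. k \<in> K \<Longrightarrow> x k = y k) \<Longrightarrow> f x = f y"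
  shows "(\<integral>x. f x \<partial>M) = (\<Sum>v\<in>(\<Pi>\<^sub>E k\<in>K. UNIV). f v * measure M (cylinder K v))"
proof -
  interpret prob_space M by fact
  have sp: "space M = UNIV" using sets_eq_imp_space_eq[OF assms(2)] by simp
  let ?V = "\<Pi>\<^sub>E k\<in>K. (UNIV :: cell set)"
  have fin: "finite ?V" using assms(3) by (intro finite_PiE) auto
  have "f x = (\<Sum>v\<in>?V. f v * indicator (cylinder K v) x)" for x
  proof -
    have "f v * indicator (cylinder K v) x = (if v = restrict x K then f x else 0)" if v: "v \<in> ?V" for v
    proof (cases "x \<in> cylinder K v")
      case True
      then have "v = restrict x K"
        using v by (intro ext) (auto simp: cylinder_def PiE_iff extensional_def restrict_def)
      moreover have "f v = f x" using True by (intro loc) (simp add: cylinder_def)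
      ultimately show ?thesis using True by simp
    next
      case False
      then have "v \<noteq> restrict x K" by (auto simp: cylinder_def)
      then show ?thesis using False by simp
    qed
    then have "(\<Sum>v\<in>?V. f v * indicator (cylinder K v) x) = (\<Sum>v\<in>?V. if v = restrict x K then f x else 0)"
      by (rule sum.cong[OF refl])
    also have "\<dots> = f x" using fin by (simp add: PiE_iff)
    finally show ?thesis ..
  qed
  then have "(\<integral>x. f x \<partial>M) = (\<integral>x. (\<Sum>v\<in>?V. f v * indicator (cylinder K v) x) \<partial>M)"
    by (rule Bochner_Integration.integral_cong[OF refl])
  also have "\<dots> = (\<Sum>v\<in>?V. f v * measure M (cylinder K v))"
    using assms(2,3) sp by (subst Bochner_Integration.integral_sum)
      (auto intro!: integrable_mult_right integrable_real_indicator simp: cylinder_sets emeasure_eq_measure)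
  finally show ?thesis .
qed

lemma shift_image_cylinder: "shift (- k) ` cylinder J v = cylinder ((+) k ` J) (shift (- k) v)"
proof safe
  fix x assume "x \<in> cylinder J v"
  then show "shift (- k) x \<in> cylinder ((+) k ` J) (shift (- k) v)"
    by (auto simp: cylinder_def shift_def)
next
  fix x assume "x \<in> cylinder ((+) k ` J) (shift (- k) v)"
  then have "shift k x \<in> cylinder J v" by (auto simp: cylinder_def shift_def)
  moreover have "x = shift (- k) (shift k x)" by (simp add: shift_def fun_eq_iff)
  ultimately show "x \<in> shift (- k) ` cylinder J v" by blast
qed

lemma shift_measurable [measurable]: "shift k \<in> borel \<rightarrow>\<^sub>M borel"
  by (rule measurable_conf) (simp add: shift_def)

lemma vimage_shift_cylinder: "shift k -` cylinder J v = cylinder ((+) k ` J) (shift (- k) v)"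
  by (auto simp: cylinder_def shift_def)

lemma gliders_shift: "gliders (shift k x) = shift k (gliders x)"
proof (intro ext)
  fix j i show "gliders (shift k x) j i = shift k (gliders x) j i"
    by (cases i) (simp_all add: gliders_simps shift_def algebra_simps)
qed

section \<open>The law of the trajectories\<close>

locale noisy_gliders = birth_death_noise +
  fixes \<Phi> :: "conf \<Rightarrow> conf measure"
  assumes noisy_version: "noisy_version gliders \<theta> \<Phi>"
begin

lemma kernel: "\<Phi> \<in> borel \<rightarrow>\<^sub>M prob_algebra borel"
  using noisy_version by (simp add: noisy_version_def)

lemma kernel_sub [measurable]: "\<Phi> \<in> borel \<rightarrow>\<^sub>M subprob_algebra borel"
  using kernel by (rule measurable_prob_algebraD)

lemma kernel_space: "\<Phi> x \<in> space (prob_algebra borel)"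
  using measurable_space[OF kernel] by simp

lemma kernel_cylinder:
  "finite K \<Longrightarrow> measure (\<Phi> x) (cylinder K y) = (\<Prod>k\<in>K. \<theta> (gliders x k) (y k))"
  using noisy_version by (simp add: noisy_version_def)

lemma kernel_power_space: "kernel_power \<Phi> n x \<in> space (prob_algebra borel)"
proof (induction n)
  case 0
  show ?case by (simp add: space_prob_algebra prob_space_return)
next
  case (Suc n)
  show ?case using prob_space_bind'[OF Suc kernel] sets_bind'[OF Suc kernel]
    by (simp add: space_prob_algebra)
qed

lemma kernel_power_measurable: "kernel_power \<Phi> n \<in> borel \<rightarrow>\<^sub>M prob_algebra borel"
proof (induction n)
  case 0
  have "return borel \<in> borel \<rightarrow>\<^sub>M prob_algebra (borel :: conf measure)" by measurable
  then show ?case by (simp cong: measurable_cong)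
next
  case (Suc n)
  note [measurable] = Suc kernel
  have "(\<lambda>x. kernel_power \<Phi> n x \<bind> \<Phi>) \<in> borel \<rightarrow>\<^sub>M prob_algebra borel" by measurable
  then show ?case by (simp cong: measurable_cong)
qed

definition nbhd :: "int set \<Rightarrow> int set" where
  "nbhd K = {j. \<exists>k\<in>K. \<bar>j - k\<bar> \<le> 1}"

lemma finite_nbhd: "finite K \<Longrightarrow> finite (nbhd K)"
proof -
  assume "finite K"
  moreover have "nbhd K \<subseteq> (\<Union>k\<in>K. {k - 1..k + 1})"
    unfolding nbhd_def by (force simp: abs_le_iff)
  ultimately show ?thesis by (meson finite_UN finite_atLeastAtMost_int finite_subset)
qed

text \<open>One step looks one site to either side. The resulting finite linear combination serves
  the recursion for the law of trajectories and takes the place of the Feller property in the proof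
  of invariance.\<close>

lemma measure_bind_kernel:
  assumes "M \<in> space (prob_algebra borel)" "finite K"
  shows "measure (M \<bind> \<Phi>) (cylinder K u) =
    (\<Sum>v\<in>(\<Pi>\<^sub>E k\<in>nbhd K. UNIV). (\<Prod>k\<in>K. \<theta> (gliders v k) (u k)) * measure M (cylinder (nbhd K) v))"
proof -
  from assms(1) have M: "prob_space M" "sets M = sets borel" by (simp_all add: space_prob_algebra)
  interpret M: prob_space M by fact
  have "\<Phi> \<in> M \<rightarrow>\<^sub>M subprob_algebra borel"
    using kernel_sub M(2) by (simp cong: measurable_cong_sets)
  then have "measure (M \<bind> \<Phi>) (cylinder K u) = (\<integral>x. measure (\<Phi> x) (cylinder K u) \<partial>M)"
    by (rule M.measure_bind[OF _ cylinder_sets[OF assms(2)]])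
  also have "\<dots> = (\<integral>x. (\<Prod>k\<in>K. \<theta> (gliders x k) (u k)) \<partial>M)"
    using assms(2) by (simp add: kernel_cylinder)
  also have "\<dots> = (\<Sum>v\<in>(\<Pi>\<^sub>E k\<in>nbhd K. UNIV). (\<Prod>k\<in>K. \<theta> (gliders v k) (u k)) * measure M (cylinder (nbhd K) v))"
  proof (rule integral_local[OF M finite_nbhd[OF assms(2)]])
    fix x y :: conf assume "\<And>k. k \<in> nbhd K \<Longrightarrow> x k = y k"
    then have "gliders x k = gliders y k" if "k \<in> K" for k
      using that by (intro gliders_cong) (auto simp: nbhd_def)
    then show "(\<Prod>k\<in>K. \<theta> (gliders x k) (u k)) = (\<Prod>k\<in>K. \<theta> (gliders y k) (u k))" by simp
  qed
  finally show ?thesis .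
qed

lemma prob_row:
  assumes "finite K"
  shows "samples.prob {\<omega>. \<forall>p\<in>K \<times> UNIV. (\<omega> (noise_index t (fst p) (snd p)) < thr (snd p) (y (fst p) (snd p)))
      = u (fst p) (snd p)} = (\<Prod>k\<in>K. \<theta> (y k) (u k))"
proof -
  let ?n = "\<lambda>p. noise_index t (fst p) (snd p)"
  let ?E = "\<lambda>p \<omega>. (\<omega> (?n p) < thr (snd p) (y (fst p) (snd p))) = u (fst p) (snd p)"
  have single: "samples.prob {\<omega>. (\<omega> n < c) = b} = (if b then c else 1 - c)" if "0 \<le> c" "c \<le> 1" for n c b
  proof (cases b)
    case False
    have "{\<omega>. \<omega> n < c} \<in> samples.events" by (intro pred_events) measurable
    then have "samples.prob (UNIV - {\<omega>. \<omega> n < c}) = 1 - c"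
      using samples.prob_compl[of "{\<omega>. \<omega> n < c}"] that by (simp add: prob_sample_less)
    moreover have "{\<omega>. (\<omega> n < c) = b} = UNIV - {\<omega>. \<omega> n < c}" using False by auto
    ultimately show ?thesis using False by simp
  qed (simp add: prob_sample_less that)
  have "samples.prob {\<omega>. \<forall>p\<in>K \<times> UNIV. ?E p \<omega>} = (\<Prod>p\<in>K \<times> UNIV. samples.prob {\<omega>. ?E p \<omega>})"
  proof (rule prob_Ball_depends_on[where H = "\<lambda>p. {?n p}"])
    show "disjoint_family_on (\<lambda>p. {?n p}) (K \<times> UNIV)"
      by (auto simp: disjoint_family_on_def noise_index_eq_iff)
  qed (use assms in \<open>auto simp: depends_on_def\<close>)
  also have "\<dots> = (\<Prod>p\<in>K \<times> UNIV. birth_death1 (\<beta> (snd p)) (\<delta> (snd p)) (y (fst p) (snd p)) (u (fst p) (snd p)))"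
    using thr by (intro prod.cong refl) (simp add: single birth_death1_thr less_imp_le)
  also have "\<dots> = (\<Prod>k\<in>K. \<theta> (y k) (u k))"
    by (simp add: birth_death_def prod.cartesian_product case_prod_beta)
  finally show ?thesis .
qed

lemma traj_measurable [measurable]: "(\<lambda>\<omega>. traj \<omega> x n t) \<in> uniform_samples \<rightarrow>\<^sub>M borel"
  by (rule measurable_conf) measurable

text \<open>Row \<open>t\<close> acts last and shares no sample with the rows before it in time, so
  given the pattern on the neighbourhood its samples produce the product of the noise probabilities.
  The row number \<open>t\<close> is kept general since the recursion passes to
  \<open>Suc t\<close>; the law depends on \<open>n\<close> only.\<close>

lemma law_traj:
  "finite K \<Longrightarrow> samples.prob {\<omega>. traj \<omega> x n t \<in> cylinder K u} = measure (kernel_power \<Phi> n x) (cylinder K u)"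
proof (induction n arbitrary: t K u)
  case 0
  then show ?case
    using samples.prob_space by (auto simp: measure_return cylinder_sets indicator_def)
next
  case (Suc n)
  let ?V = "\<Pi>\<^sub>E k\<in>nbhd K. (UNIV :: cell set)"
  let ?T = "\<lambda>v. {\<omega>. traj \<omega> x n (Suc t) \<in> cylinder (nbhd K) v}"
  have ev: "{\<omega>. traj \<omega> x m s \<in> cylinder J v} \<in> samples.events" if "finite J" for m s J v
    using measurable_sets[OF traj_measurable cylinder_sets[OF that]] by (simp add: vimage_def)
  have fin: "finite (nbhd K)" "finite ?V"
    using finite_nbhd[OF Suc.prems] by (auto intro: finite_PiE)
  let ?row = "\<lambda>v \<omega>. \<forall>p\<in>K \<times> UNIV. (\<omega> (noise_index t (fst p) (snd p)) < thr (snd p) (gliders v (fst p) (snd p)))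
      = u (fst p) (snd p)"
  have rowm: "Measurable.pred uniform_samples (?row v)" for v
    using Suc.prems by (intro pred_intros_finite) auto
  have "samples.prob {\<omega>. traj \<omega> x (Suc n) t \<in> cylinder K u} =
      samples.prob (\<Union>v\<in>?V. {\<omega>. traj \<omega> x n (Suc t) \<in> cylinder (nbhd K) v \<and> ?row v \<omega>})"
  proof (rule arg_cong[where f = samples.prob], rule set_eqI)
    fix \<omega>
    let ?x = "traj \<omega> x n (Suc t)"
    have gl: "gliders ?x k = gliders v k" if "?x \<in> cylinder (nbhd K) v" "k \<in> K" for v k
      using that by (intro gliders_cong) (auto simp: cylinder_def nbhd_def)
    have row: "traj \<omega> x (Suc n) t \<in> cylinder K u \<longleftrightarrow> ?row v \<omega>" if "?x \<in> cylinder (nbhd K) v" for v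
      using gl[OF that] by (auto simp: cylinder_def fun_eq_iff)
    have "?x \<in> cylinder (nbhd K) (restrict ?x (nbhd K))" by (simp add: cylinder_def)
    moreover have "restrict ?x (nbhd K) \<in> ?V" by auto
    ultimately have "traj \<omega> x (Suc n) t \<in> cylinder K u \<longleftrightarrow>
        (\<exists>v\<in>?V. ?x \<in> cylinder (nbhd K) v \<and> ?row v \<omega>)"
      using row by metis
    then show "\<omega> \<in> {\<omega>. traj \<omega> x (Suc n) t \<in> cylinder K u} \<longleftrightarrow>
        \<omega> \<in> (\<Union>v\<in>?V. {\<omega>. traj \<omega> x n (Suc t) \<in> cylinder (nbhd K) v \<and> ?row v \<omega>})"
      unfolding mem_Collect_eq UN_iff .
  qed
  also have "\<dots> = (\<Sum>v\<in>?V. samples.prob {\<omega>. traj \<omega> x n (Suc t) \<in> cylinder (nbhd K) v \<and> ?row v \<omega>})"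
  proof (rule samples.finite_measure_finite_Union[OF fin(2)])
    have "Measurable.pred uniform_samples (\<lambda>\<omega>. traj \<omega> x n (Suc t) \<in> cylinder (nbhd K) v)" for v
      using ev[OF fin(1)] by (simp add: pred_def)
    then show "(\<lambda>v. {\<omega>. traj \<omega> x n (Suc t) \<in> cylinder (nbhd K) v \<and> ?row v \<omega>}) ` ?V \<subseteq> samples.events"
      by (intro image_subsetI pred_events pred_intros_logic rowm)
    have "v = w" if "v \<in> ?V" "w \<in> ?V" "z \<in> cylinder (nbhd K) v" "z \<in> cylinder (nbhd K) w" for v w z
      using that by (intro PiE_ext[OF that(1,2)]) (auto simp: cylinder_def)
    then show "disjoint_family_on (\<lambda>v. {\<omega>. traj \<omega> x n (Suc t) \<in> cylinder (nbhd K) v \<and> ?row v \<omega>}) ?V"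
      unfolding disjoint_family_on_def by (intro ballI impI equals0I) (metis (mono_tags, lifting) IntE mem_Collect_eq)
  qed
  also have "\<dots> = (\<Sum>v\<in>?V. (\<Prod>k\<in>K. \<theta> (gliders v k) (u k)) * measure (kernel_power \<Phi> n x) (cylinder (nbhd K) v))"
  proof (rule sum.cong[OF refl])
    fix v assume "v \<in> ?V"
    have "samples.prob {\<omega>. traj \<omega> x n (Suc t) \<in> cylinder (nbhd K) v \<and> ?row v \<omega>} =
        samples.prob (?T v) * samples.prob {\<omega>. ?row v \<omega>}"
    proof (rule prob_conj_depends_on[OF _ _ _ rowm])
      let ?I = "{noise_index s j c | s j c. Suc t \<le> s}" and ?J = "{noise_index t j c | j c. True}"
      show "depends_on ?I (\<lambda>\<omega>. traj \<omega> x n (Suc t) \<in> cylinder (nbhd K) v)"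
      proof (rule depends_onI)
        fix \<omega> \<omega>' :: "nat \<Rightarrow> real" assume eq: "\<And>j. j \<in> ?I \<Longrightarrow> \<omega> j = \<omega>' j"
        have "traj \<omega> x n (Suc t) k = traj \<omega>' x n (Suc t) k" for k
          by (rule depends_onD[OF depends_on_traj], rule eq) (auto simp: cone_def)
        then show "(traj \<omega> x n (Suc t) \<in> cylinder (nbhd K) v) = (traj \<omega>' x n (Suc t) \<in> cylinder (nbhd K) v)"
          by (simp add: cylinder_def)
      qed
      show "depends_on ?J (?row v)"
      proof (rule depends_onI)
        fix \<omega> \<omega>' :: "nat \<Rightarrow> real" assume eq: "\<And>j. j \<in> ?J \<Longrightarrow> \<omega> j = \<omega>' j"
        have "\<omega> (noise_index t j c) = \<omega>' (noise_index t j c)" for j c by (rule eq) auto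
        then show "?row v \<omega> = ?row v \<omega>'" by simp
      qed
      show "?I \<inter> ?J = {}" by (auto simp: noise_index_eq_iff)
      show "Measurable.pred uniform_samples (\<lambda>\<omega>. traj \<omega> x n (Suc t) \<in> cylinder (nbhd K) v)"
        using ev[OF fin(1)] by (simp add: pred_def)
    qed
    then show "samples.prob {\<omega>. traj \<omega> x n (Suc t) \<in> cylinder (nbhd K) v \<and> ?row v \<omega>} =
        (\<Prod>k\<in>K. \<theta> (gliders v k) (u k)) * measure (kernel_power \<Phi> n x) (cylinder (nbhd K) v)"
      using Suc.IH[OF fin(1)] prob_row[OF Suc.prems, of t "gliders v" u] by simp
  qed
  also have "\<dots> = measure (kernel_power \<Phi> (Suc n) x) (cylinder K u)"
    using measure_bind_kernel[OF kernel_power_space Suc.prems] by simp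
  finally show ?case .
qed

end

section \<open>Ergodicity and mixing\<close>

context birth_death_noise
begin

text \<open>A component that never becomes known gets the default \<open>False\<close>. By
  \<open>gap_tendsto_0\<close> this has probability zero.\<close>

definition limit_conf :: "(nat \<Rightarrow> real) \<Rightarrow> conf" where
  "limit_conf \<omega> = (\<lambda>k i. \<exists>n. known \<omega> UNIV n 0 k i = Some True)"

lemma known_imp_limit_conf:
  assumes "known \<omega> S n 0 k i = Some b"
  shows "limit_conf \<omega> k i = b"
  using assms known_Some_unique[OF assms] known_mono[OF assms order.refl subset_UNIV]
  unfolding limit_conf_def by (cases b) auto

lemma limit_conf_measurable [measurable]: "limit_conf \<in> uniform_samples \<rightarrow>\<^sub>M borel"
  unfolding limit_conf_def by (rule measurable_conf) measurable

definition limit_measure :: "conf measure" where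
  "limit_measure = distr uniform_samples borel limit_conf"

lemma prob_limit_measure: "prob_space limit_measure"
  unfolding limit_measure_def by (rule samples.prob_space_distr) measurable

lemma sets_limit_measure [simp]: "sets limit_measure = sets borel"
  by (simp add: limit_measure_def)

lemma limit_measure_space: "limit_measure \<in> space (prob_algebra borel)"
  by (simp add: space_prob_algebra prob_limit_measure)

lemma measure_limit_measure:
  "finite K \<Longrightarrow> measure limit_measure (cylinder K u) = samples.prob {\<omega>. limit_conf \<omega> \<in> cylinder K u}"
  unfolding limit_measure_def by (subst measure_distr) (auto simp: cylinder_sets vimage_def)

section \<open>The coupling error between the limit and finite trajectories\<close>

definition unknown :: "int set \<Rightarrow> nat \<Rightarrow> (nat \<Rightarrow> real) set" where
  "unknown K n = (\<Union>p\<in>K \<times> UNIV. {\<omega>. known \<omega> UNIV n 0 (fst p) (snd p) = None})"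

lemma unknown_events: "finite K \<Longrightarrow> unknown K n \<in> samples.events"
  unfolding unknown_def by (intro sets.finite_UN pred_events measurable_known_eq) auto

lemma card_UNIV_comp: "card (UNIV :: comp set) = 3"
  by (simp add: UNIV_comp)

lemma prob_unknown:
  assumes "finite K"
  shows "samples.prob (unknown K n) \<le> 3 * card K * gap n"
proof -
  have "samples.prob (unknown K n) \<le>
      (\<Sum>p\<in>K \<times> UNIV. samples.prob {\<omega>. known \<omega> UNIV n 0 (fst p) (snd p) = None})"
    unfolding unknown_def using assms
    by (intro samples.finite_measure_subadditive_finite)
      (auto intro!: pred_events measurable_known_eq)
  also have "\<dots> \<le> (\<Sum>p\<in>K \<times> (UNIV :: comp set). gap n)"
    by (intro sum_mono prob_unknown_le_gap)
  also have "\<dots> = 3 * card K * gap n"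
    by (simp add: card_cartesian_product card_UNIV_comp)
  finally show ?thesis .
qed

lemma limit_conf_eq_traj:
  assumes "\<omega> \<notin> unknown K n" "k \<in> K"
  shows "limit_conf \<omega> k = traj \<omega> x n 0 k"
proof
  fix i
  obtain b where "known \<omega> UNIV n 0 k i = Some b"
    using assms unfolding unknown_def by fastforce
  then show "limit_conf \<omega> k i = traj \<omega> x n 0 k i"
    using known_imp_limit_conf known_imp_traj by metis
qed

lemma (in prob_space) abs_prob_diff_le:
  assumes "A \<in> events" "B \<in> events" "C \<in> events" "A \<subseteq> B \<union> C" "B \<subseteq> A \<union> C"
  shows "\<bar>prob A - prob B\<bar> \<le> prob C"
proof -
  have "prob A \<le> prob B + prob C"
    using finite_measure_mono[OF assms(4)] measure_Un_le[OF assms(2,3)] assms by auto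
  moreover have "prob B \<le> prob A + prob C"
    using finite_measure_mono[OF assms(5)] measure_Un_le[OF assms(1,3)] assms by auto
  ultimately show ?thesis by linarith
qed

lemma traj_events: "finite K \<Longrightarrow> {\<omega>. traj \<omega> x n t \<in> cylinder K u} \<in> samples.events"
  using measurable_sets[OF measurable_conf[OF measurable_traj] cylinder_sets]
  by (simp add: vimage_def)

lemma limit_conf_events: "finite K \<Longrightarrow> {\<omega>. limit_conf \<omega> \<in> cylinder K u} \<in> samples.events"
  using measurable_sets[OF limit_conf_measurable cylinder_sets] by (simp add: vimage_def)

text \<open>The coupling inequality: both configurations read the same samples and can differ on
  \<open>K\<close> only inside \<open>unknown K n\<close>. The bound is independent of
  \<open>x\<close>, for uniformity, and of the position of \<open>K\<close>, for mixing.\<close>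

lemma limit_traj_close:
  assumes "finite K"
  shows "\<bar>measure limit_measure (cylinder K u) - samples.prob {\<omega>. traj \<omega> x n 0 \<in> cylinder K u}\<bar>
    \<le> 3 * card K * gap n"
proof -
  have "limit_conf \<omega> \<in> cylinder K u \<longleftrightarrow> traj \<omega> x n 0 \<in> cylinder K u" if "\<omega> \<notin> unknown K n" for \<omega>
    using limit_conf_eq_traj[OF that] by (simp add: cylinder_def)
  then have "\<bar>samples.prob {\<omega>. limit_conf \<omega> \<in> cylinder K u} - samples.prob {\<omega>. traj \<omega> x n 0 \<in> cylinder K u}\<bar>
      \<le> samples.prob (unknown K n)"
    using assms
    by (intro samples.abs_prob_diff_le traj_events limit_conf_events unknown_events) auto
  then show ?thesis
    using prob_unknown[OF assms, of n] by (simp add: measure_limit_measure[OF assms])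
qed

end

section \<open>Uniform convergence, invariance and uniqueness\<close>

context noisy_gliders
begin

lemma kernel_power_close:
  "finite K \<Longrightarrow> \<bar>measure (kernel_power \<Phi> n x) (cylinder K u) - measure limit_measure (cylinder K u)\<bar>
    \<le> 3 * card K * gap n"
  using limit_traj_close[of K u x n] law_traj[of K x n 0 u] by (simp add: abs_minus_commute)

lemma gap_scaled_tendsto: "(\<lambda>n. c * gap n) \<longlonglongrightarrow> 0"
  using tendsto_mult_right_zero[OF gap_tendsto_0] .

lemma uniform_limit_kernel_power:
  assumes "finite K"
  shows "uniform_limit UNIV (\<lambda>t x. measure (kernel_power \<Phi> t x) (cylinder K u))
    (\<lambda>x. measure limit_measure (cylinder K u)) sequentially"
proof (rule uniform_limitI)
  fix e :: real assume "0 < e"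
  then have "\<forall>\<^sub>F n in sequentially. 3 * card K * gap n < e"
    using order_tendstoD(2)[OF gap_scaled_tendsto] by blast
  then show "\<forall>\<^sub>F n in sequentially. \<forall>x\<in>UNIV.
      dist (measure (kernel_power \<Phi> n x) (cylinder K u)) (measure limit_measure (cylinder K u)) < e"
    by eventually_elim (auto simp: dist_real_def intro: le_less_trans[OF kernel_power_close[OF assms]])
qed

lemma kernel_power_tendsto:
  "finite K \<Longrightarrow> (\<lambda>n. measure (kernel_power \<Phi> n x) (cylinder K u)) \<longlonglongrightarrow> measure limit_measure (cylinder K u)"
  using tendsto_uniform_limitI[OF uniform_limit_kernel_power, of K x] by simp

text \<open>The cylinder probabilities at time \<open>Suc n\<close> have two limits: as a shifted
  sequence that of \<open>limit_measure\<close>, and through the finite one-step formula that of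
  \<open>limit_measure \<bind> \<Phi>\<close>.\<close>

lemma invariant_limit_measure: "invariant \<Phi> limit_measure"
proof -
  have "limit_measure \<bind> \<Phi> = limit_measure"
  proof (rule measure_eqI_cylinder)
    fix K u assume fin: "finite (K :: int set)"
    have "(\<lambda>n. measure (kernel_power \<Phi> (Suc n) x) (cylinder K u)) \<longlonglongrightarrow> measure (limit_measure \<bind> \<Phi>) (cylinder K u)" for x
      unfolding kernel_power.simps measure_bind_kernel[OF kernel_power_space fin]
        measure_bind_kernel[OF limit_measure_space fin]
      by (intro tendsto_intros kernel_power_tendsto finite_nbhd fin)
    moreover have "(\<lambda>n. measure (kernel_power \<Phi> (Suc n) x) (cylinder K u)) \<longlonglongrightarrow> measure limit_measure (cylinder K u)" for x
      using kernel_power_tendsto[OF fin] by (rule LIMSEQ_Suc)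
    ultimately show "measure (limit_measure \<bind> \<Phi>) (cylinder K u) = measure limit_measure (cylinder K u)"
      using LIMSEQ_unique by blast
  qed (use prob_space_bind'[OF limit_measure_space kernel] sets_bind'[OF limit_measure_space kernel]
      prob_limit_measure in auto)
  then show ?thesis by (simp add: invariant_def prob_limit_measure)
qed

lemma invariant_kernel_power:
  assumes "invariant \<Phi> \<pi>"
  shows "\<pi> \<bind> kernel_power \<Phi> n = \<pi>"
proof (induction n)
  case 0
  have "kernel_power \<Phi> 0 = return borel" by (simp add: fun_eq_iff)
  then show ?case using assms by (simp add: invariant_def bind_return'')
next
  case (Suc n)
  have sets: "sets \<pi> = sets borel" using assms by (simp add: invariant_def)
  have "kernel_power \<Phi> n \<in> \<pi> \<rightarrow>\<^sub>M subprob_algebra borel"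
    using measurable_prob_algebraD[OF kernel_power_measurable] sets by (simp cong: measurable_cong_sets)
  from bind_assoc[OF this kernel_sub] Suc
  have "\<pi> \<bind> \<Phi> = \<pi> \<bind> (\<lambda>x. kernel_power \<Phi> n x \<bind> \<Phi>)" by simp
  also have "(\<lambda>x. kernel_power \<Phi> n x \<bind> \<Phi>) = kernel_power \<Phi> (Suc n)" by (simp add: fun_eq_iff)
  finally show ?case using assms by (simp add: invariant_def)
qed

text \<open>An invariant measure is the average over its own points of the laws after
  \<open>n\<close> steps, and all of these are within the same distance of
  \<open>limit_measure\<close>.\<close>

lemma invariant_unique:
  assumes "invariant \<Phi> \<pi>"
  shows "\<pi> = limit_measure"
proof (rule measure_eqI_cylinder)
  show \<pi>: "prob_space \<pi>" "sets \<pi> = sets borel" using assms by (simp_all add: invariant_def)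
  interpret prob_space \<pi> by fact
  fix K u assume fin: "finite (K :: int set)"
  have close: "\<bar>measure \<pi> (cylinder K u) - measure limit_measure (cylinder K u)\<bar> \<le> 3 * card K * gap n" for n
  proof -
    have kp: "kernel_power \<Phi> n \<in> \<pi> \<rightarrow>\<^sub>M subprob_algebra borel"
      using measurable_prob_algebraD[OF kernel_power_measurable] \<pi>(2) by (simp cong: measurable_cong_sets)
    have "measure \<pi> (cylinder K u) = (\<integral>x. measure (kernel_power \<Phi> n x) (cylinder K u) \<partial>\<pi>)"
      using measure_bind[OF kp cylinder_sets[OF fin]] invariant_kernel_power[OF assms] by simp
    moreover have int: "integrable \<pi> (\<lambda>x. measure (kernel_power \<Phi> n x) (cylinder K u))"
    proof (rule integrable_const_bound[where B = 1])
      show "AE x in \<pi>. norm (measure (kernel_power \<Phi> n x) (cylinder K u)) \<le> 1"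
        using kernel_power_space by (simp add: space_prob_algebra prob_space.prob_le_1)
      show "(\<lambda>x. measure (kernel_power \<Phi> n x) (cylinder K u)) \<in> borel_measurable \<pi>"
        by (rule measurable_compose[OF kp measurable_measure_subprob_algebra[OF cylinder_sets[OF fin]]])
    qed
    moreover have "measure limit_measure (cylinder K u) - 3 * card K * gap n \<le> measure (kernel_power \<Phi> n x) (cylinder K u)"
        "measure (kernel_power \<Phi> n x) (cylinder K u) \<le> measure limit_measure (cylinder K u) + 3 * card K * gap n" for x
      using kernel_power_close[OF fin, of n x u] by linarith+
    then have "measure limit_measure (cylinder K u) - 3 * card K * gap n \<le> (\<integral>x. measure (kernel_power \<Phi> n x) (cylinder K u) \<partial>\<pi>)"
        "(\<integral>x. measure (kernel_power \<Phi> n x) (cylinder K u) \<partial>\<pi>) \<le> measure limit_measure (cylinder K u) + 3 * card K * gap n"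
      using int by (auto intro!: integral_ge_const integral_le_const)
    ultimately show ?thesis by linarith
  qed
  have "(\<lambda>n. 3 * card K * gap n) \<longlonglongrightarrow> 0" by (rule gap_scaled_tendsto)
  then have "\<bar>measure \<pi> (cylinder K u) - measure limit_measure (cylinder K u)\<bar> \<le> 0"
    by (rule LIMSEQ_le_const) (use close in blast)
  then show "measure \<pi> (cylinder K u) = measure limit_measure (cylinder K u)" by simp
qed (use prob_limit_measure in auto)

lemma uniformly_ergodic: "uniformly_ergodic \<Phi>"
  unfolding uniformly_ergodic_def
  using invariant_limit_measure invariant_unique uniform_limit_kernel_power by blast

section \<open>Translation invariance and spatial mixing\<close>

lemma kernel_shift: "\<Phi> (shift k x) = distr (\<Phi> x) borel (shift k)"
proof (rule measure_eqI_cylinder)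
  have \<Phi>: "prob_space (\<Phi> x)" "sets (\<Phi> x) = sets borel" for x
    using kernel_space[of x] by (simp_all add: space_prob_algebra)
  interpret prob_space "\<Phi> x" by fact
  have s: "shift k \<in> \<Phi> x \<rightarrow>\<^sub>M borel" using \<Phi>(2)[of x] shift_measurable by (simp cong: measurable_cong_sets)
  show "prob_space (distr (\<Phi> x) borel (shift k))" by (rule prob_space_distr[OF s])
  fix K y assume fin: "finite (K :: int set)"
  have sp: "space (\<Phi> x) = UNIV" using sets_eq_imp_space_eq[OF \<Phi>(2)] by simp
  have "measure (distr (\<Phi> x) borel (shift k)) (cylinder K y) = measure (\<Phi> x) (cylinder ((+) k ` K) (shift (- k) y))"
    by (simp add: measure_distr[OF s cylinder_sets[OF fin]] sp vimage_shift_cylinder)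
  also have "\<dots> = (\<Prod>j\<in>(+) k ` K. \<theta> (gliders x j) (shift (- k) y j))"
    using fin by (simp add: kernel_cylinder)
  also have "\<dots> = (\<Prod>j\<in>K. \<theta> (gliders (shift k x) j) (y j))"
    unfolding gliders_shift by (subst prod.reindex) (auto simp: shift_def)
  finally show "measure (\<Phi> (shift k x)) (cylinder K y) = measure (distr (\<Phi> x) borel (shift k)) (cylinder K y)"
    using fin by (simp add: kernel_cylinder)
qed (use kernel_space in \<open>simp_all add: space_prob_algebra\<close>)

text \<open>The kernel commutes with shifts, so a shifted invariant measure is again invariant, and
  uniqueness applies.\<close>

lemma limit_measure_shift: "distr limit_measure borel (shift k) = limit_measure"
proof (rule invariant_unique, unfold invariant_def, intro conjI)
  have s: "shift k \<in> limit_measure \<rightarrow>\<^sub>M borel" using shift_measurable by (simp cong: measurable_cong_sets)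
  have \<Phi>: "\<Phi> \<in> limit_measure \<rightarrow>\<^sub>M subprob_algebra borel" using kernel_sub by (simp cong: measurable_cong_sets)
  have ne: "space limit_measure \<noteq> {}" by (simp add: limit_measure_def)
  interpret prob_space limit_measure by (rule prob_limit_measure)
  show "prob_space (distr limit_measure borel (shift k))" by (rule prob_space_distr[OF s])
  have "distr limit_measure borel (shift k) \<bind> \<Phi> = limit_measure \<bind> (\<lambda>x. \<Phi> (shift k x))"
    by (rule bind_distr[OF s kernel_sub ne])
  also have "\<dots> = distr (limit_measure \<bind> \<Phi>) borel (shift k)"
    unfolding kernel_shift by (rule distr_bind[OF \<Phi> ne, symmetric]) measurable
  also have "\<dots> = distr limit_measure borel (shift k)"
    using invariant_limit_measure by (simp add: invariant_def)
  finally show "distr limit_measure borel (shift k) \<bind> \<Phi> = distr limit_measure borel (shift k)" .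
qed simp

lemma measure_limit_shift:
  assumes "finite J"
  shows "measure limit_measure (cylinder ((+) k ` J) (shift (- k) v)) = measure limit_measure (cylinder J v)"
proof -
  have s: "shift k \<in> limit_measure \<rightarrow>\<^sub>M borel" using shift_measurable by (simp cong: measurable_cong_sets)
  have sp: "space limit_measure = UNIV" by (simp add: limit_measure_def)
  have "measure (distr limit_measure borel (shift k)) (cylinder J v) =
      measure limit_measure (cylinder ((+) k ` J) (shift (- k) v))"
    by (simp add: measure_distr[OF s cylinder_sets[OF assms]] sp vimage_shift_cylinder)
  then show ?thesis by (simp add: limit_measure_shift)
qed

text \<open>After \<open>n\<close> rows a cell has read samples from sites within distance
  \<open>n\<close> only, so the two patterns use disjoint samples and the independence is
  exact.\<close>

lemma traj_independent:
  assumes fin: "finite K" "finite J" and far: "\<And>a b. a \<in> K \<Longrightarrow> b \<in> J \<Longrightarrow> \<bar>a - b\<bar> > 2 * int n"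
  shows "samples.prob {\<omega>. traj \<omega> x n 0 \<in> cylinder K u \<inter> cylinder J v} =
    samples.prob {\<omega>. traj \<omega> x n 0 \<in> cylinder K u} * samples.prob {\<omega>. traj \<omega> x n 0 \<in> cylinder J v}"
proof -
  have dep: "depends_on (\<Union>k\<in>A. cone n 0 k) (\<lambda>\<omega>. traj \<omega> x n 0 \<in> cylinder A w)" for A w
  proof (rule depends_onI)
    fix \<omega> \<omega>' :: "nat \<Rightarrow> real" assume eq: "\<And>j. j \<in> (\<Union>k\<in>A. cone n 0 k) \<Longrightarrow> \<omega> j = \<omega>' j"
    have "traj \<omega> x n 0 k = traj \<omega>' x n 0 k" if "k \<in> A" for k
      by (rule depends_onD[OF depends_on_traj]) (use that eq in blast)
    then show "(traj \<omega> x n 0 \<in> cylinder A w) = (traj \<omega>' x n 0 \<in> cylinder A w)"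
      by (simp add: cylinder_def)
  qed
  have "cone n 0 a \<inter> cone n 0 b = {}" if "a \<in> K" "b \<in> J" for a b
  proof -
    have "\<bar>j - a\<bar> > int n \<or> \<bar>j - b\<bar> > int n" for j using far[OF that] by linarith
    then show ?thesis unfolding cone_def by (fastforce simp: noise_index_eq_iff not_less[symmetric])
  qed
  then have disj: "(\<Union>k\<in>K. cone n 0 k) \<inter> (\<Union>k\<in>J. cone n 0 k) = {}"
    by (simp add: Int_UN_distrib2)
  have pred: "Measurable.pred uniform_samples (\<lambda>\<omega>. traj \<omega> x n 0 \<in> cylinder A w)" if "finite A" for A w
    using traj_events[OF that] by (simp add: pred_def)
  show ?thesis
    using prob_conj_depends_on[OF dep pred[OF fin(1)] dep pred[OF fin(2)] disj] by simp
qed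

lemma spatially_mixing_limit_measure: "spatially_mixing limit_measure"
  unfolding spatially_mixing_def
proof (intro allI impI)
  fix K J :: "int set" and u v :: conf
  assume fin: "finite K" "finite J"
  let ?p = "measure limit_measure (cylinder K u)" and ?q = "measure limit_measure (cylinder J v)"
  show "((\<lambda>k. measure limit_measure (cylinder K u \<inter> shift (- k) ` cylinder J v)) \<longlongrightarrow> ?p * ?q)
      (filtercomap (\<lambda>k::int. \<bar>k\<bar>) at_top)"
  proof (rule tendstoI)
    fix e :: real assume "0 < e"
    \<comment> \<open>One coupling error for the joint pattern, with \<open>card K + card J\<close>
      cells, and one for each of its two parts.\<close>
    define c where "c = 3 * real (card K + card J) + 3 * card K + 3 * card J"
    have "\<forall>\<^sub>F n in sequentially. c * gap n < e"
      using order_tendstoD(2)[OF gap_scaled_tendsto \<open>0 < e\<close>] .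
    then obtain n where n: "c * gap n < e" by (auto simp: eventually_sequentially)
    obtain B where B: "\<And>a b. a \<in> K \<Longrightarrow> b \<in> J \<Longrightarrow> \<bar>a - b\<bar> \<le> B"
    proof -
      have "finite ((\<lambda>(a, b). \<bar>a - b\<bar>) ` (K \<times> J))" using fin by simp
      then show ?thesis using that[of "Max ((\<lambda>(a, b). \<bar>a - b\<bar>) ` (K \<times> J))"]
        by (metis (no_types, lifting) Max_ge SigmaI case_prod_conv image_eqI)
    qed
    \<comment> \<open>\<open>B\<close> bounds the distances between \<open>K\<close> and
      \<open>J\<close>, so after the translation by \<open>k\<close> they are at least
      \<open>\<bar>k\<bar> - B\<close>, hence more than \<open>2 * int n\<close>.\<close>
    have "dist (measure limit_measure (cylinder K u \<inter> shift (- k) ` cylinder J v)) (?p * ?q) < e"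
      if k: "\<bar>k\<bar> \<ge> B + 2 * int n + 1" for k
    proof -
      define J' v' where "J' = (+) k ` J" and "v' = shift (- k) v"
      have fin': "finite J'" using fin by (simp add: J'_def)
      have card: "card J' = card J" by (simp add: J'_def card_image)
      have far: "\<bar>a - b\<bar> > 2 * int n" if "a \<in> K" "b \<in> J'" for a b
      proof -
        obtain b' where "b' \<in> J" "b = k + b'" using \<open>b \<in> J'\<close> by (auto simp: J'_def)
        with B[OF \<open>a \<in> K\<close> \<open>b' \<in> J\<close>] k show ?thesis by linarith
      qed
      have disj: "K \<inter> J' = {}" using far by fastforce
      define w where "w j = (if j \<in> K then u j else v' j)" for j
      have inter: "cylinder K u \<inter> cylinder J' v' = cylinder (K \<union> J') w"
        using disj by (auto simp: cylinder_def w_def)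
      define T where "T A y = samples.prob {\<omega>. traj \<omega> (\<lambda>_ _. False) n 0 \<in> cylinder A y}" for A y
      have close: "\<bar>measure limit_measure (cylinder A y) - T A y\<bar> \<le> 3 * card A * gap n" if "finite A" for A y
        unfolding T_def using limit_traj_close[OF that] .
      have prod: "T (K \<union> J') w = T K u * T J' v'"
        unfolding T_def inter[symmetric] by (rule traj_independent[OF fin(1) fin' far])
      have q: "measure limit_measure (cylinder J' v') = ?q"
        unfolding J'_def v'_def by (rule measure_limit_shift[OF fin(2)])
      have "0 \<le> gap n" using rate by (simp add: gap_def)
      have "\<bar>T K u * T J' v' - ?p * ?q\<bar> \<le> 3 * card K * gap n + 3 * card J * gap n"
      proof -
        have "T K u * T J' v' - ?p * ?q = (T K u - ?p) * T J' v' + ?p * (T J' v' - ?q)"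
          by (simp add: algebra_simps)
        also have "\<bar>\<dots>\<bar> \<le> \<bar>T K u - ?p\<bar> * \<bar>T J' v'\<bar> + \<bar>?p\<bar> * \<bar>T J' v' - ?q\<bar>"
          by (metis abs_mult abs_triangle_ineq)
        also have "\<dots> \<le> \<bar>T K u - ?p\<bar> * 1 + 1 * \<bar>T J' v' - ?q\<bar>"
          by (intro add_mono mult_mono) (auto simp: T_def prob_space.prob_le_1[OF prob_limit_measure])
        also have "\<dots> \<le> 3 * card K * gap n + 3 * card J * gap n"
          using close[OF fin(1), of u] close[OF fin', of v'] by (simp add: card q abs_minus_commute)
        finally show ?thesis .
      qed
      moreover have "\<bar>measure limit_measure (cylinder (K \<union> J') w) - T (K \<union> J') w\<bar> \<le> 3 * real (card K + card J) * gap n"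
        using close[of "K \<union> J'" w] fin fin' by (simp add: card_Un_disjoint disj card)
      ultimately have "\<bar>measure limit_measure (cylinder (K \<union> J') w) - ?p * ?q\<bar> \<le> c * gap n"
        unfolding prod c_def by (simp add: distrib_right)
      then show ?thesis
        unfolding shift_image_cylinder J'_def[symmetric] v'_def[symmetric] inter dist_real_def
        using n by linarith
    qed
    then show "\<forall>\<^sub>F k in filtercomap (\<lambda>k::int. \<bar>k\<bar>) at_top.
        dist (measure limit_measure (cylinder K u \<inter> shift (- k) ` cylinder J v)) (?p * ?q) < e"
      unfolding eventually_filtercomap eventually_at_top_linorder by blast
  qed
qed

end

section \<open>Total correctness of programs\<close>

text \<open>Since \<open>exec\<close> is deterministic, one terminating run with the right result is
  total correctness.\<close>

definition total ::
  "(cell \<Rightarrow> cell \<Rightarrow> real) \<Rightarrow> (nat \<Rightarrow> real) \<Rightarrow> prog \<Rightarrow> (memory \<Rightarrow> bool) \<Rightarrow> (memory \<Rightarrow> bool) \<Rightarrow> bool" where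
  "total \<theta> \<omega> P Pre Post \<longleftrightarrow> (\<forall>s. Pre s \<longrightarrow> (\<exists>s'. exec \<theta> \<omega> P s s' \<and> Post s'))"

lemma total_Skip: "(\<And>s. Pre s \<Longrightarrow> Post s) \<Longrightarrow> total \<theta> \<omega> Skip Pre Post"
  unfolding total_def using exec_Skip by blast

lemma total_ISet:
  "(\<And>s. Pre s \<Longrightarrow> Post (s\<lparr>ints := store a (ival s e) (ival s f) (ints s)\<rparr>)) \<Longrightarrow> total \<theta> \<omega> (ISet a e f) Pre Post"
  unfolding total_def using exec_ISet by blast

lemma total_Seq: "total \<theta> \<omega> P Pre Mid \<Longrightarrow> total \<theta> \<omega> Q Mid Post \<Longrightarrow> total \<theta> \<omega> (Seq P Q) Pre Post"
  unfolding total_def using exec_Seq by blast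

lemma total_Cond:
  assumes "total \<theta> \<omega> P (\<lambda>s. Pre s \<and> bval \<theta> s b) Post" "total \<theta> \<omega> Q (\<lambda>s. Pre s \<and> \<not> bval \<theta> s b) Post"
  shows "total \<theta> \<omega> (Cond b P Q) Pre Post"
  using assms unfolding total_def by (metis exec_CondT exec_CondF)

lemma total_weaken:
  "total \<theta> \<omega> P Pre Post \<Longrightarrow> (\<And>s. Pre' s \<Longrightarrow> Pre s) \<Longrightarrow> (\<And>s. Post s \<Longrightarrow> Post' s) \<Longrightarrow> total \<theta> \<omega> P Pre' Post'"
  unfolding total_def by blast

text \<open>For loops whose number of rounds \<open>m\<close> is known beforehand; the index of
  \<open>I\<close> is both the invariant's parameter and the variant.\<close>

lemma total_While:
  assumes "\<And>n s. n < m \<Longrightarrow> I n s \<Longrightarrow> bval \<theta> s b" "\<And>s. I m s \<Longrightarrow> \<not> bval \<theta> s b"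
    and "\<And>n. n < m \<Longrightarrow> total \<theta> \<omega> P (I n) (I (Suc n))"
  shows "total \<theta> \<omega> (While b P) (I 0) (I m)"
proof -
  have "\<exists>s'. exec \<theta> \<omega> (While b P) s s' \<and> I m s'" if "I n s" "n \<le> m" for n s
    using that
  proof (induction "m - n" arbitrary: n s)
    case 0
    then show ?case using assms(2) exec_WhileF by (metis diff_is_0_eq le_antisym)
  next
    case (Suc d)
    then have "n < m" by simp
    then obtain s1 where "exec \<theta> \<omega> P s s1" "I (Suc n) s1"
      using assms(3) Suc.prems unfolding total_def by blast
    moreover have "d = m - Suc n" using Suc.hyps(2) by simp
    ultimately obtain s' where "exec \<theta> \<omega> P s s1" "exec \<theta> \<omega> (While b P) s1 s'" "I m s'"
      using Suc.hyps(1)[of "Suc n" s1] \<open>n < m\<close> by auto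
    then show ?case using assms(1)[OF \<open>n < m\<close> Suc.prems(1)] exec_WhileT by blast
  qed
  then show ?thesis unfolding total_def by blast
qed

text \<open>The outer loop has no a priori bound and may run forever on some samples, so its runs
  are characterised in both directions. \<open>S\<close> iterates the body regardless of the
  guard.\<close>

lemma exec_While_iff:
  assumes body: "\<And>n. total \<theta> \<omega> P (I n) (I (Suc n))" and "I 0 s"
  shows "\<exists>S. (\<forall>n. I n (S n)) \<and>
    (\<forall>s'. exec \<theta> \<omega> (While b P) s s' \<longleftrightarrow> (\<exists>n. (\<forall>m<n. bval \<theta> (S m) b) \<and> \<not> bval \<theta> (S n) b \<and> s' = S n))"
proof -
  have "\<exists>S. \<forall>n. (I n (S n) \<and> (n = 0 \<longrightarrow> S n = s)) \<and> exec \<theta> \<omega> P (S n) (S (Suc n))"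
  proof (rule dependent_nat_choice)
    show "\<exists>x. I 0 x \<and> (0 = 0 \<longrightarrow> x = s)" using assms(2) by blast
    fix x n assume "I n x \<and> (n = 0 \<longrightarrow> x = s)"
    then show "\<exists>y. (I (Suc n) y \<and> (Suc n = 0 \<longrightarrow> y = s)) \<and> exec \<theta> \<omega> P x y"
      using body unfolding total_def by blast
  qed
  then obtain S where S: "\<And>n. I n (S n)" "S 0 = s" "\<And>n. exec \<theta> \<omega> P (S n) (S (Suc n))"
    by blast
  have run: "exec \<theta> \<omega> (While b P) (S k) (S n)" if "\<forall>m<n. k \<le> m \<longrightarrow> bval \<theta> (S m) b" "\<not> bval \<theta> (S n) b" "k \<le> n" for k n
    using that
  proof (induction "n - k" arbitrary: k)
    case 0
    then show ?case using exec_WhileF by (metis diff_is_0_eq le_antisym)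
  next
    case (Suc d)
    then have "k < n" by simp
    then have "exec \<theta> \<omega> (While b P) (S (Suc k)) (S n)"
      using Suc by (intro Suc.hyps(1)) auto
    moreover have "bval \<theta> (S k) b" using Suc.prems \<open>k < n\<close> by blast
    ultimately show ?case using S(3) exec_WhileT by blast
  qed
  \<comment> \<open>Program and start state are variables tied down by equations, so that rule
    induction keeps the loop and lets \<open>k\<close> advance.\<close>
  have stop: "\<exists>n. (\<forall>m<n. k \<le> m \<longrightarrow> bval \<theta> (S m) b) \<and> \<not> bval \<theta> (S n) b \<and> s' = S n \<and> k \<le> n"
    if "exec \<theta> \<omega> Q r s'" "Q = While b P" "r = S k" for Q r s' k
    using that
  proof (induction arbitrary: k rule: exec.induct)
    case (exec_WhileT r c P' r1 r2)
    have [simp]: "c = b" "P' = P" "r = S k" using exec_WhileT.prems by simp_all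
    have "exec \<theta> \<omega> P (S k) r1" using exec_WhileT.hyps(2) by simp
    then have "r1 = S (Suc k)" using exec_deterministic[OF S(3)] by blast
    then obtain n where n: "\<forall>m<n. Suc k \<le> m \<longrightarrow> bval \<theta> (S m) b" "\<not> bval \<theta> (S n) b" "r2 = S n" "Suc k \<le> n"
      using exec_WhileT.IH(2)[of "Suc k"] by auto
    have "bval \<theta> (S m) b" if "m < n" "k \<le> m" for m
      using n(1) exec_WhileT.hyps(1) that by (cases "m = k") auto
    then show ?case using n by (intro exI[of _ n]) auto
  next
    case (exec_WhileF r c P')
    then show ?case by (intro exI[of _ k]) auto
  qed auto
  have "exec \<theta> \<omega> (While b P) s s' \<longleftrightarrow> (\<exists>n. (\<forall>m<n. bval \<theta> (S m) b) \<and> \<not> bval \<theta> (S n) b \<and> s' = S n)" for s'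
    using run[of _ 0] stop[OF _ refl S(2)[symmetric], of s'] S(2) by auto
  with S(1) show ?thesis by blast
qed

section \<open>The sampling program\<close>

text \<open>Integer arrays \<open>4\<close>, \<open>5\<close>, \<open>6\<close> hold the three components of the configuration at time \<open>-t\<close> and site
  \<open>k\<close> at index \<^term>\<open>site_code t k\<close>, with \<open>0\<close> for unknown, \<open>1\<close> for absent and \<open>2\<close> for present. Real
  arrays \<open>0\<close>, \<open>1\<close>, \<open>2\<close> hold the noise. Cell \<open>0\<close> of the integer arrays \<open>7\<close> to \<open>12\<close> holds the depth
  \<open>T\<close>, the current \<open>t\<close> and \<open>k\<close>, the number of triples of samples, the success flag, and the index of
  a site of the input.\<close>

abbreviation get :: "nat \<Rightarrow> iexp" where
  "get x \<equiv> IGet x (IConst 0)"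

abbreviation put :: "nat \<Rightarrow> iexp \<Rightarrow> prog" where
  "put x e \<equiv> ISet x (IConst 0) e"

definition site_exp :: "iexp \<Rightarrow> iexp \<Rightarrow> iexp" where
  "site_exp e f = (let K = IAdd e (IMul f f) in IAdd (IAdd (IMul K K) K) f)"

definition state_array :: "comp \<Rightarrow> nat" where
  "state_array i = 3 + out_array i"

definition marked :: "comp \<Rightarrow> bool \<Rightarrow> bool \<Rightarrow> cell" where
  "marked i a b = (case i of W \<Rightarrow> cell True a b | R \<Rightarrow> cell a True b | L \<Rightarrow> cell a b True)"

text \<open>Programs have access to the entries of \<open>\<theta>\<close> only. The threshold is
  recovered as a marginal: component \<open>i\<close> is marked as present, and summing over the
  other two components removes their factors.\<close>

definition thr_exp :: "comp \<Rightarrow> bool \<Rightarrow> rexp" where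
  "thr_exp i a = (let p = (\<lambda>b c. Prob (\<lambda>_. a) (marked i b c)) in
     RAdd (RAdd (p False False) (p False True)) (RAdd (p True False) (p True True)))"

text \<open>The factors are \<open>1\<close> and \<open>0\<close> without a wall, \<open>0\<close> and \<open>1\<close> at a wall, and \<open>0\<close> where the wall is unknown.\<close>

definition select_exp :: "iexp \<Rightarrow> iexp \<Rightarrow> iexp \<Rightarrow> iexp" where
  "select_exp w a b = IAdd (IMul (IMul w (ISub (IConst 2) w)) a)
     (IMul (IDiv (IMul w (ISub w (IConst 1))) (IConst 2)) b)"

definition parent_exp :: "comp \<Rightarrow> iexp" where
  "parent_exp i = (let q = (\<lambda>i f. IGet (state_array i) (site_exp (IAdd (get 8) (IConst 1)) f));
     w = q W (get 9); r = q R (ISub (get 9) (IConst 1)); l = q L (IAdd (get 9) (IConst 1)) in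
     case i of W \<Rightarrow> w | R \<Rightarrow> select_exp w r l | L \<Rightarrow> select_exp w l r)"

text \<open>Doubling modulo \<open>3\<close> fixes \<open>0\<close> and interchanges \<open>1\<close> and \<open>2\<close>: a sample between the two thresholds
  copies or flips the parent, according to the order of the thresholds.\<close>

definition update_cell :: "comp \<Rightarrow> prog" where
  "update_cell i = (let c = site_exp (get 8) (get 9); u = RGet (comp_index i) c; write = ISet (state_array i) c in
     Cond (RLess u (thr_exp i False))
       (Cond (RLess u (thr_exp i True)) (write (IConst 2)) (write (IMod (IMul (IConst 2) (parent_exp i)) (IConst 3))))
       (Cond (RLess u (thr_exp i True)) (write (parent_exp i)) (write (IConst 1))))"

definition incr :: "nat \<Rightarrow> prog" where
  "incr x = put x (IAdd (get x) (IConst 1))"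

text \<open>\<open>IMul B B\<close> exceeds every site code with \<open>t\<close> and the absolute
  value of \<open>k\<close> at most the depth, by \<open>site_code_bounds\<close>. The counter is
  never reset, so a deeper round extends the stored noise and keeps the old samples.\<close>

definition fill :: prog where
  "fill = (let B = IAdd (IAdd (get 7) (IMul (get 7) (get 7))) (IConst 1) in
     While (ILess (get 10) (IMul B B))
       (Seq (Sample 0 (get 10)) (Seq (Sample 1 (get 10)) (Seq (Sample 2 (get 10)) (incr 10)))))"

definition row :: prog where
  "row = Seq (put 9 (ISub (IConst 0) (get 7))) (While (BNot (ILess (get 7) (get 9)))
     (Seq (update_cell W) (Seq (update_cell R) (Seq (update_cell L) (incr 9)))))"

text \<open>Row \<open>T\<close> and the sites beyond the window have not been written at smaller
  depths. They still hold the \<open>0\<close> of the initial memory, which is the code of unknown,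
  so the bottom needs no initialisation.\<close>

definition sweep :: prog where
  "sweep = Seq (put 8 (get 7)) (While (ILess (IConst 0) (get 8)) (Seq (put 8 (ISub (get 8) (IConst 1))) row))"

text \<open>Subtracting 1 turns the codes of absent and present into the output values 0 and 1, and
  that of unknown into -1, which is the test for failure.\<close>

definition check_cell :: "comp \<Rightarrow> prog" where
  "check_cell i = (let k = IGet 0 (get 12) in
     Seq (ISet (out_array i) k (ISub (IGet (state_array i) (site_exp (IConst 0) k)) (IConst 1)))
       (Cond (ILess (IGet (out_array i) k) (IConst 0)) (put 11 (IConst 0)) Skip))"

definition check :: prog where
  "check = Seq (put 11 (IConst 1)) (Seq (put 12 (IConst 1)) (While (BNot (ILess (get 0) (get 12)))
     (Seq (check_cell W) (Seq (check_cell R) (Seq (check_cell L) (incr 12))))))"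

definition body :: prog where
  "body = Seq fill (Seq sweep (Seq check (incr 7)))"

definition sampler :: prog where
  "sampler = While (ILess (get 11) (IConst 1)) body"

definition code :: "bool option \<Rightarrow> int" where
  "code v = (case v of None \<Rightarrow> 0 | Some b \<Rightarrow> if b then 2 else 1)"

text \<open>The counters in arrays 7, 8, 9, 11 and 12 are left free, so writing to them preserves
  this relation; only the number of triples in array 10 is tied to the samples consumed.\<close>

definition represents ::
  "(nat \<Rightarrow> real) \<Rightarrow> int set \<Rightarrow> nat \<Rightarrow> (nat \<Rightarrow> int \<Rightarrow> comp \<Rightarrow> bool option) \<Rightarrow> (int \<Rightarrow> comp \<Rightarrow> int) \<Rightarrow> memory \<Rightarrow> bool" where
  "represents \<omega> A N st out s \<longleftrightarrow>
     ints s 0 = ints (input A) 0 \<and> ints s 10 0 = int N \<and>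
     (\<forall>t k i. ints s (state_array i) (site_code t k) = code (st t k i)) \<and>
     (\<forall>k i. ints s (out_array i) k = out k i) \<and>
     used s = 3 * N \<and> (\<forall>i m. m < N \<longrightarrow> reals s (comp_index i) (int m) = \<omega> (3 * m + comp_index i))"

lemma ival_site_exp: "ival s e = int t \<Longrightarrow> ival s (site_exp e f) = site_code t (ival s f)"
  by (simp add: site_exp_def site_code_def Let_def)

lemma out_array_simps: "out_array i \<noteq> 0" "out_array i \<noteq> state_array j"
  "state_array j \<noteq> out_array i" "state_array i \<noteq> 0"
  "7 \<le> x \<Longrightarrow> out_array i \<noteq> x" "7 \<le> x \<Longrightarrow> state_array i \<noteq> x"
  "state_array i = state_array j \<longleftrightarrow> i = j" "out_array i = out_array j \<longleftrightarrow> i = j"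
  by (auto simp: out_array_def state_array_def split: comp.splits)

lemma represents_put:
  "7 \<le> x \<Longrightarrow> x \<noteq> 10 \<Longrightarrow> represents \<omega> A N st out (s\<lparr>ints := store x 0 c (ints s)\<rparr>) \<longleftrightarrow> represents \<omega> A N st out s"
  by (simp add: represents_def store_def out_array_simps)

section \<open>Correctness of the pieces of the program\<close>

context birth_death_noise
begin

lemma rval_thr_exp: "rval \<theta> s (thr_exp i a) = thr i a"
proof -
  have p: "\<theta> x y = birth_death1 (\<beta> W) (\<delta> W) (x W) (y W) * (birth_death1 (\<beta> R) (\<delta> R) (x R) (y R) *
      birth_death1 (\<beta> L) (\<delta> L) (x L) (y L))" for x y
    by (simp add: birth_death_def UNIV_comp)
  show ?thesis
    unfolding thr_exp_def Let_def rval.simps p birth_death1_thr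
    by (cases i) (simp_all add: marked_def cell_def algebra_simps)
qed

lemma code_noisy: "code (noisy i u v) =
   (if u < thr i False then if u < thr i True then 2 else (2 * code v) mod 3
    else if u < thr i True then code v else 1)"
  by (cases v; cases "the v") (auto simp: noisy_def code_def)

lemma ival_parent_exp:
  assumes "represents \<omega> A N st out s" "ints s 8 0 = int t" "ints s 9 0 = k"
  shows "ival s (parent_exp i) = code (parent (st (Suc t)) k i)"
proof -
  have q: "ival s (IGet (state_array j) (site_exp (IAdd (get 8) (IConst 1)) f)) = code (st (Suc t) (ival s f) j)" for j f
    using assms ival_site_exp[of s "IAdd (get 8) (IConst 1)" "Suc t" f] by (simp add: represents_def)
  have "ival s (select_exp e f g) = (case w of None \<Rightarrow> 0 | Some w \<Rightarrow> if w then ival s g else ival s f)"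
    if "ival s e = code w" for e f g w
    using that by (cases w) (auto simp: select_exp_def code_def)
  note sel = this[of _ "st (Suc t) k W"]
  show ?thesis
    using assms q
    by (cases i) (auto simp: parent_exp_def Let_def parent_def sel code_def split: option.split)
qed

definition upd_state where
  "upd_state st t k i x = (\<lambda>t' k' i'. if t' = t \<and> k' = k \<and> i' = i then x else st t' k' i')"

lemma total_update_cell:
  assumes N: "site_code t k < int N"
  shows "total \<theta> \<omega> (update_cell i)
    (\<lambda>s. represents \<omega> A N st out s \<and> ints s 7 0 = T \<and> ints s 8 0 = int t \<and> ints s 9 0 = k)
    (\<lambda>s. represents \<omega> A N (upd_state st t k i (noisy i (\<omega> (noise_index t k i)) (parent (st (Suc t)) k i))) out s \<and>
       ints s 7 0 = T \<and> ints s 8 0 = int t \<and> ints s 9 0 = k)"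
  unfolding total_def
proof (intro allI impI)
  fix s assume s: "represents \<omega> A N st out s \<and> ints s 7 0 = T \<and> ints s 8 0 = int t \<and> ints s 9 0 = k"
  let ?x = "noisy i (\<omega> (noise_index t k i)) (parent (st (Suc t)) k i)"
  let ?s = "s\<lparr>ints := store (state_array i) (site_code t k) (code ?x) (ints s)\<rparr>"
  have c: "ival s (site_exp (get 8) (get 9)) = site_code t k"
    using s ival_site_exp[of s "get 8" t "get 9"] by simp
  have u: "rval \<theta> s (RGet (comp_index i) (site_exp (get 8) (get 9))) = \<omega> (noise_index t k i)"
  proof -
    have "reals s (comp_index i) (int (nat (site_code t k))) = \<omega> (3 * nat (site_code t k) + comp_index i)"
      using s N site_code_nonneg[of t k] unfolding represents_def by (metis nat_less_iff)
    then show ?thesis using c site_code_nonneg[of t k] by (simp add: noise_index_def)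
  qed
  have wr: "exec \<theta> \<omega> (ISet (state_array i) (site_exp (get 8) (get 9)) e) s ?s" if "ival s e = code ?x" for e
    using exec_ISet[of \<theta> \<omega> "state_array i" "site_exp (get 8) (get 9)" e s] that c by simp
  have par: "ival s (parent_exp i) = code (parent (st (Suc t)) k i)"
    using s ival_parent_exp by blast
  let ?u = "RGet (comp_index i) (site_exp (get 8) (get 9))"
  have lt: "bval \<theta> s (RLess ?u (thr_exp i a)) \<longleftrightarrow> \<omega> (noise_index t k i) < thr i a" for a
    by (simp only: bval.simps u rval_thr_exp)
  have cond: "exec \<theta> \<omega> (Cond b P Q) s s'" if "bval \<theta> s b \<Longrightarrow> exec \<theta> \<omega> P s s'" "\<not> bval \<theta> s b \<Longrightarrow> exec \<theta> \<omega> Q s s'" for b P Q s'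
    using that exec_CondT exec_CondF by blast
  have "exec \<theta> \<omega> (update_cell i) s ?s"
    unfolding update_cell_def Let_def
    by (intro cond wr) (simp_all only: lt, simp_all add: code_noisy par)
  moreover have "represents \<omega> A N (upd_state st t k i ?x) out ?s \<and> ints ?s 7 0 = T \<and> ints ?s 8 0 = int t \<and> ints ?s 9 0 = k"
    using s by (auto simp: represents_def store_def out_array_simps upd_state_def site_code_eq_iff)
  ultimately show "\<exists>s'. exec \<theta> \<omega> (update_cell i) s s' \<and> represents \<omega> A N (upd_state st t k i ?x) out s' \<and>
      ints s' 7 0 = T \<and> ints s' 8 0 = int t \<and> ints s' 9 0 = k" by blast
qed

lemma total_incr:
  "(\<And>s. Pre s \<Longrightarrow> Post (s\<lparr>ints := store x 0 (ints s x 0 + 1) (ints s)\<rparr>)) \<Longrightarrow> total \<theta> \<omega> (incr x) Pre Post"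
  unfolding incr_def by (rule total_ISet) simp

lemma total_fill:
  "total \<theta> \<omega> fill (\<lambda>s. represents \<omega> A N st out s \<and> ints s 7 0 = int T)
    (\<lambda>s. \<exists>N'. represents \<omega> A N' st out s \<and> ints s 7 0 = int T \<and>
       (int T + int T * int T + 1) * (int T + int T * int T + 1) \<le> int N')"
proof -
  let ?B = "(int T + int T * int T + 1) * (int T + int T * int T + 1)"
  define I where "I n s \<longleftrightarrow> represents \<omega> A (N + n) st out s \<and> ints s 7 0 = int T" for n s
  \<comment> \<open>\<open>n\<close> counts the new triples. The truncation by \<open>nat\<close>
    covers the case that enough triples are already stored, when the loop makes no round.\<close>
  have "total \<theta> \<omega> fill (I 0) (I (nat (?B - int N)))"
    unfolding fill_def Let_def
  proof (rule total_While)
    fix n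
    show "total \<theta> \<omega> (Seq (Sample 0 (get 10)) (Seq (Sample 1 (get 10)) (Seq (Sample 2 (get 10)) (incr 10))))
        (I n) (I (Suc n))"
      unfolding total_def
    proof (intro allI impI)
      fix s assume s: "I n s"
      define m where "m = N + n"
      have rep: "represents \<omega> A m st out s" and m: "ints s 10 0 = int m" "used s = 3 * m"
        using s by (auto simp: I_def represents_def m_def)
      define s1 where "s1 = s\<lparr>reals := store 0 (int m) (\<omega> (3 * m)) (reals s), used := Suc (3 * m)\<rparr>"
      define s2 where "s2 = s1\<lparr>reals := store 1 (int m) (\<omega> (3 * m + 1)) (reals s1), used := Suc (Suc (3 * m))\<rparr>"
      define s3 where "s3 = s2\<lparr>reals := store 2 (int m) (\<omega> (3 * m + 2)) (reals s2), used := Suc (Suc (Suc (3 * m)))\<rparr>"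
      define s4 where "s4 = s3\<lparr>ints := store 10 0 (int m + 1) (ints s3)\<rparr>"
      have "exec \<theta> \<omega> (Sample 0 (get 10)) s s1"
        using exec_Sample[of \<theta> \<omega> 0 "get 10" s] m by (simp add: s1_def)
      moreover have "exec \<theta> \<omega> (Sample 1 (get 10)) s1 s2"
        using exec_Sample[of \<theta> \<omega> 1 "get 10" s1] m by (simp add: s1_def s2_def)
      moreover have "exec \<theta> \<omega> (Sample 2 (get 10)) s2 s3"
        using exec_Sample[of \<theta> \<omega> 2 "get 10" s2] m by (simp add: s1_def s2_def s3_def)
      moreover have "exec \<theta> \<omega> (incr 10) s3 s4"
        using exec_ISet[of \<theta> \<omega> 10 "IConst 0" "IAdd (get 10) (IConst 1)" s3] m
        by (simp add: s1_def s2_def s3_def s4_def incr_def)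
      moreover have "I (Suc n) s4"
      proof -
        have r: "reals s4 = store 2 (int m) (\<omega> (3 * m + 2)) (store 1 (int m) (\<omega> (3 * m + 1)) (store 0 (int m) (\<omega> (3 * m)) (reals s)))"
          and i: "ints s4 = store 10 0 (int m + 1) (ints s)" and u: "used s4 = 3 * Suc m"
          by (simp_all add: s1_def s2_def s3_def s4_def)
        have "reals s4 (comp_index c) (int l) = \<omega> (3 * l + comp_index c)" if "l < Suc m" for c l
        proof (cases "l = m")
          case True
          then show ?thesis by (cases c) (simp_all add: r store_def comp_index_def)
        next
          case False
          then have "reals s4 (comp_index c) (int l) = reals s (comp_index c) (int l)"
            by (simp add: r store_def)
          with False that rep show ?thesis by (simp add: represents_def)
        qed
        moreover have "ints s4 0 = ints (input A) 0" "ints s4 10 0 = int (Suc m)" "ints s4 7 0 = int T"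
          "ints s4 (state_array c) (site_code t k) = code (st t k c)" "ints s4 (out_array c) j = out j c" for c t k j
          using rep s unfolding i I_def by (auto simp: store_def out_array_simps represents_def)
        ultimately show ?thesis by (simp add: I_def represents_def u m_def)
      qed
      ultimately show "\<exists>s'. exec \<theta> \<omega> (Seq (Sample 0 (get 10)) (Seq (Sample 1 (get 10)) (Seq (Sample 2 (get 10)) (incr 10)))) s s' \<and> I (Suc n) s'"
        by (blast intro: exec_Seq)
    qed
  qed (auto simp: I_def represents_def)
  then show ?thesis
    by (rule total_weaken) (auto simp: I_def intro!: exI[of _ "N + nat (?B - int N)"])
qed

lemma total_row:
  assumes N: "\<And>k. \<bar>k\<bar> \<le> int T \<Longrightarrow> site_code t k < int N"
  shows "total \<theta> \<omega> row
    (\<lambda>s. represents \<omega> A N st out s \<and> ints s 7 0 = int T \<and> ints s 8 0 = int t)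
    (\<lambda>s. represents \<omega> A N (\<lambda>t' k i. if t' = t \<and> \<bar>k\<bar> \<le> int T
        then noisy i (\<omega> (noise_index t k i)) (parent (st (Suc t)) k i) else st t' k i) out s \<and>
      ints s 7 0 = int T \<and> ints s 8 0 = int t)"
proof -
  define new where "new k i = noisy i (\<omega> (noise_index t k i)) (parent (st (Suc t)) k i)" for k i
  define part where "part n = (\<lambda>t' k i. if t' = t \<and> - int T \<le> k \<and> k < - int T + int n then new k i else st t' k i)" for n
  define I where "I n s \<longleftrightarrow> represents \<omega> A N (part n) out s \<and> ints s 7 0 = int T \<and> ints s 8 0 = int t \<and>
    ints s 9 0 = - int T + int n" for n s
  have "total \<theta> \<omega> row (\<lambda>s. represents \<omega> A N st out s \<and> ints s 7 0 = int T \<and> ints s 8 0 = int t) (I (2 * T + 1))"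
    unfolding row_def
  proof (rule total_Seq[OF total_ISet total_While])
    fix s assume s: "represents \<omega> A N st out s \<and> ints s 7 0 = int T \<and> ints s 8 0 = int t"
    have "part 0 = st" by (auto simp: part_def fun_eq_iff)
    with s show "I 0 (s\<lparr>ints := store 9 (ival s (IConst 0)) (ival s (ISub (IConst 0) (get 7))) (ints s)\<rparr>)"
      by (simp add: I_def represents_put) (simp add: store_def)
  next
    fix n assume n: "n < 2 * T + 1"
    define k where "k = - int T + int n"
    have sc: "site_code t k < int N" using n by (intro N) (auto simp: k_def)
    define st1 where "st1 = upd_state (part n) t k W (new k W)"
    define st2 where "st2 = upd_state st1 t k R (new k R)"
    define st3 where "st3 = upd_state st2 t k L (new k L)"
    \<comment> \<open>Only row \<open>t\<close> is written and only row \<open>Suc t\<close> is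
      read. Updating the three components in place, one after another, is therefore the same as
      updating them simultaneously.\<close>
    have suc: "part n (Suc t) = st (Suc t)" "st1 (Suc t) = st (Suc t)" "st2 (Suc t) = st (Suc t)"
      by (simp_all add: part_def st1_def st2_def upd_state_def)
    have st3: "st3 = part (Suc n)"
    proof (intro ext)
      fix t' j i show "st3 t' j i = part (Suc n) t' j i"
        by (cases i) (auto simp: st3_def st2_def st1_def upd_state_def part_def k_def)
    qed
    let ?at = "\<lambda>s. ints s 7 0 = int T \<and> ints s 8 0 = int t \<and> ints s 9 0 = k"
    have "total \<theta> \<omega> (update_cell W) (I n) (\<lambda>s. represents \<omega> A N st1 out s \<and> ?at s)"
      using total_update_cell[OF sc, of \<omega> W A "part n" out "int T"]
      unfolding I_def[abs_def] suc new_def[symmetric] st1_def[symmetric] k_def[symmetric] .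
    moreover have "total \<theta> \<omega> (update_cell R) (\<lambda>s. represents \<omega> A N st1 out s \<and> ?at s) (\<lambda>s. represents \<omega> A N st2 out s \<and> ?at s)"
      using total_update_cell[OF sc, of \<omega> R A st1 out "int T"]
      by (simp add: suc new_def[symmetric] st2_def[symmetric])
    moreover have "total \<theta> \<omega> (update_cell L) (\<lambda>s. represents \<omega> A N st2 out s \<and> ?at s) (\<lambda>s. represents \<omega> A N st3 out s \<and> ?at s)"
      using total_update_cell[OF sc, of \<omega> L A st2 out "int T"]
      by (simp add: suc new_def[symmetric] st3_def[symmetric])
    moreover have "total \<theta> \<omega> (incr 9) (\<lambda>s. represents \<omega> A N st3 out s \<and> ?at s) (I (Suc n))"
      by (rule total_incr, simp add: I_def represents_put st3) (simp add: store_def k_def)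
    ultimately show "total \<theta> \<omega> (Seq (update_cell W) (Seq (update_cell R) (Seq (update_cell L) (incr 9)))) (I n) (I (Suc n))"
      by (intro total_Seq)
  qed (auto simp: I_def)
  moreover have "part (2 * T + 1) = (\<lambda>t' k i. if t' = t \<and> \<bar>k\<bar> \<le> int T then new k i else st t' k i)"
    by (auto simp: part_def fun_eq_iff)
  ultimately show ?thesis
    unfolding new_def by (elim total_weaken) (auto simp: I_def)
qed

lemma total_sweep:
  assumes N: "(int T + int T * int T + 1) * (int T + int T * int T + 1) \<le> int N"
    and st: "\<And>t k i. T \<le> t \<or> int T < \<bar>k\<bar> \<Longrightarrow> st t k i = None"
  shows "total \<theta> \<omega> sweep (\<lambda>s. represents \<omega> A N st out s \<and> ints s 7 0 = int T)
    (\<lambda>s. represents \<omega> A N (\<lambda>t. known \<omega> {- int T..int T} (T - t) t) out s \<and> ints s 7 0 = int T)"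
proof -
  define kn where "kn t = known \<omega> {- int T..int T} (T - t) t" for t
  \<comment> \<open>Rows from \<open>T - n\<close> on belong to the present depth; the rows still to
    be overwritten hold \<open>st\<close>, left from before the sweep.\<close>
  define part where "part n = (\<lambda>t. if T - n \<le> t then kn t else st t)" for n
  define I where "I n s \<longleftrightarrow> represents \<omega> A N (part n) out s \<and> ints s 7 0 = int T \<and> ints s 8 0 = int (T - n)" for n s
  have "total \<theta> \<omega> sweep (\<lambda>s. represents \<omega> A N st out s \<and> ints s 7 0 = int T) (I T)"
    unfolding sweep_def
  proof (rule total_Seq[OF total_ISet total_While])
    fix s assume s: "represents \<omega> A N st out s \<and> ints s 7 0 = int T"
    have "part 0 = st" using st by (auto simp: part_def kn_def fun_eq_iff)
    with s show "I 0 (s\<lparr>ints := store 8 (ival s (IConst 0)) (ival s (get 7)) (ints s)\<rparr>)"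
      by (simp add: I_def represents_put) (simp add: store_def)
  next
    fix n assume n: "n < T"
    define t where "t = T - Suc n"
    have Suc_t: "Suc t = T - n" "T - t = Suc (T - Suc t)" "t < T" using n by (auto simp: t_def)
    have sc: "site_code t k < int N" if "\<bar>k\<bar> \<le> int T" for k
    proof -
      have "k * k \<le> int T * int T" using that by (metis abs_ge_zero abs_mult_self_eq mult_mono' order_trans)
      then have "int t + k * k + 1 \<le> int T + int T * int T + 1" using Suc_t by linarith
      then have "(int t + k * k + 1) * (int t + k * k + 1) \<le> (int T + int T * int T + 1) * (int T + int T * int T + 1)"
        by (intro mult_mono) auto
      with site_code_bounds(2)[of t k] N show ?thesis by linarith
    qed
    have new: "(\<lambda>t' k i. if t' = t \<and> \<bar>k\<bar> \<le> int T then noisy i (\<omega> (noise_index t k i)) (parent (part n (Suc t)) k i) else part n t' k i) =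
        part (Suc n)"
    proof (intro ext)
      fix t' k i
      have "part n (Suc t) = kn (Suc t)" by (simp add: part_def Suc_t)
      moreover have "kn t k i = (if \<bar>k\<bar> \<le> int T then noisy i (\<omega> (noise_index t k i)) (parent (kn (Suc t)) k i) else None)"
        unfolding kn_def Suc_t(2) by (auto simp: abs_le_iff)
      moreover have "st t k i = None" if "\<not> \<bar>k\<bar> \<le> int T" using that by (intro st) simp
      moreover have "T - n \<le> t' \<longleftrightarrow> t < t'" "T - Suc n \<le> t' \<longleftrightarrow> t \<le> t'" using n by (auto simp: t_def)
      ultimately show "(if t' = t \<and> \<bar>k\<bar> \<le> int T then noisy i (\<omega> (noise_index t k i)) (parent (part n (Suc t)) k i) else part n t' k i) =
          part (Suc n) t' k i"
        unfolding part_def by auto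
    qed
    let ?M = "\<lambda>s. represents \<omega> A N (part n) out s \<and> ints s 7 0 = int T \<and> ints s 8 0 = int t"
    have "total \<theta> \<omega> (put 8 (ISub (get 8) (IConst 1))) (I n) ?M"
    proof (rule total_ISet)
      fix s assume s: "I n s"
      have "int (T - n) - 1 = int t" using n by (simp add: t_def)
      with s show "?M (s\<lparr>ints := store 8 (ival s (IConst 0)) (ival s (ISub (get 8) (IConst 1))) (ints s)\<rparr>)"
        by (simp add: I_def represents_put) (simp add: store_def)
    qed
    moreover have "total \<theta> \<omega> row ?M (I (Suc n))"
    proof -
      have "total \<theta> \<omega> row ?M (\<lambda>s. represents \<omega> A N (\<lambda>t' k i. if t' = t \<and> \<bar>k\<bar> \<le> int T
          then noisy i (\<omega> (noise_index t k i)) (parent (part n (Suc t)) k i) else part n t' k i) out s \<and>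
          ints s 7 0 = int T \<and> ints s 8 0 = int t)"
        by (rule total_row) (rule sc)
      from this[unfolded new] show ?thesis unfolding I_def[abs_def] t_def .
    qed
    ultimately show "total \<theta> \<omega> (Seq (put 8 (ISub (get 8) (IConst 1))) row) (I n) (I (Suc n))"
      by (rule total_Seq)
  qed (auto simp: I_def)
  moreover have "part T = kn" by (simp add: part_def fun_eq_iff)
  ultimately show ?thesis
    unfolding kn_def[abs_def] by (elim total_weaken) (auto simp: I_def)
qed

lemma input_array:
  assumes "represents \<omega> A N st out s" "finite A"
  shows "ints s 0 0 = int (card A)" "n < card A \<Longrightarrow> ints s 0 (1 + int n) = sorted_list_of_set A ! n"
  using assms by (simp_all add: represents_def input_def)

lemma total_check_cell:
  assumes "finite A" "n < card A"
  defines "k \<equiv> sorted_list_of_set A ! n"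
  shows "total \<theta> \<omega> (check_cell i)
    (\<lambda>s. represents \<omega> A N st out s \<and> ints s 7 0 = T \<and> ints s 12 0 = 1 + int n \<and> ints s 11 0 = of_bool b)
    (\<lambda>s. represents \<omega> A N st (\<lambda>k' i'. if k' = k \<and> i' = i then code (st 0 k i) - 1 else out k' i') s \<and>
      ints s 7 0 = T \<and> ints s 12 0 = 1 + int n \<and> ints s 11 0 = of_bool (b \<and> st 0 k i \<noteq> None))"
    (is "total _ _ _ ?Pre ?Post")
proof -
  let ?out = "\<lambda>k' i'. if k' = k \<and> i' = i then code (st 0 k i) - 1 else out k' i'"
  let ?M = "\<lambda>s. represents \<omega> A N st ?out s \<and> ints s 7 0 = T \<and> ints s 12 0 = 1 + int n \<and> ints s 11 0 = of_bool b"
  have elem: "ival s (IGet 0 (get 12)) = k" if "represents \<omega> A N st o' s" "ints s 12 0 = 1 + int n" for s o'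
    using input_array(2)[OF that(1) assms(1,2)] that(2) by (simp add: k_def)
  show ?thesis
    unfolding check_cell_def Let_def
  proof (rule total_Seq[OF total_ISet total_Cond[OF total_ISet total_Skip]])
    fix s assume s: "?Pre s"
    have "ival s (IGet (state_array i) (site_exp (IConst 0) (IGet 0 (get 12)))) = code (st 0 k i)"
      using s ival_site_exp[of s "IConst 0" 0 "IGet 0 (get 12)"] elem[of out s] by (simp add: represents_def)
    with s elem[of out s] show "?M (s\<lparr>ints := store (out_array i) (ival s (IGet 0 (get 12)))
        (ival s (ISub (IGet (state_array i) (site_exp (IConst 0) (IGet 0 (get 12)))) (IConst 1))) (ints s)\<rparr>)"
      by (auto simp: represents_def store_def out_array_simps)
  next
    have none: "code (st 0 k i) - 1 < 0 \<longleftrightarrow> st 0 k i = None"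
      by (simp add: code_def split: option.split)
    have "ival s (IGet (out_array i) (IGet 0 (get 12))) = code (st 0 k i) - 1" if "?M s" for s
      using that elem[of ?out s] by (simp add: represents_def)
    then have guard: "bval \<theta> s (ILess (IGet (out_array i) (IGet 0 (get 12))) (IConst 0)) \<longleftrightarrow> st 0 k i = None"
      if "?M s" for s
      using that by (simp only: bval.simps ival.simps(1) none)
    fix s
    show "?Post (s\<lparr>ints := store 11 (ival s (IConst 0)) (ival s (IConst 0)) (ints s)\<rparr>)"
      if "?M s \<and> bval \<theta> s (ILess (IGet (out_array i) (IGet 0 (get 12))) (IConst 0))"
    proof -
      have "st 0 k i = None" using guard that by blast
      with that show ?thesis by (simp add: represents_put) (simp add: store_def)
    qed
    show "?Post s" if "?M s \<and> \<not> bval \<theta> s (ILess (IGet (out_array i) (IGet 0 (get 12))) (IConst 0))"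
    proof -
      have "st 0 k i \<noteq> None" using guard that by blast
      with that show ?thesis by simp
    qed
  qed
qed

lemma total_check:
  assumes A: "finite A"
  shows "total \<theta> \<omega> check (\<lambda>s. represents \<omega> A N st out s \<and> ints s 7 0 = T)
    (\<lambda>s. represents \<omega> A N st (\<lambda>k i. if k \<in> A then code (st 0 k i) - 1 else out k i) s \<and>
      ints s 7 0 = T \<and> ints s 11 0 = of_bool (\<forall>k\<in>A. \<forall>i. st 0 k i \<noteq> None))"
proof -
  define xs where "xs = sorted_list_of_set A"
  have xs: "set xs = A" "length xs = card A" using A by (simp_all add: xs_def)
  define o' where "o' n = (\<lambda>k i. if k \<in> set (take n xs) then code (st 0 k i) - 1 else out k i)" for n
  define ok where "ok n \<longleftrightarrow> (\<forall>k\<in>set (take n xs). \<forall>i. st 0 k i \<noteq> None)" for n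
  define I where "I n s \<longleftrightarrow> represents \<omega> A N st (o' n) s \<and> ints s 7 0 = T \<and> ints s 12 0 = 1 + int n \<and> ints s 11 0 = of_bool (ok n)" for n s
  have "total \<theta> \<omega> check (\<lambda>s. represents \<omega> A N st out s \<and> ints s 7 0 = T) (I (card A))"
    unfolding check_def
  proof (rule total_Seq[OF total_ISet total_Seq[OF total_ISet total_While]])
    let ?M = "\<lambda>s. represents \<omega> A N st out s \<and> ints s 7 0 = T \<and> ints s 11 0 = 1"
    fix s
    show "represents \<omega> A N st out s \<and> ints s 7 0 = T \<Longrightarrow>
        ?M (s\<lparr>ints := store 11 (ival s (IConst 0)) (ival s (IConst 1)) (ints s)\<rparr>)"
      by (simp add: represents_put) (simp add: store_def)
    show "?M s \<Longrightarrow> I 0 (s\<lparr>ints := store 12 (ival s (IConst 0)) (ival s (IConst 1)) (ints s)\<rparr>)"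
      by (simp add: I_def represents_put o'_def ok_def) (simp add: store_def)
  next
    fix n s
    show "I n s \<Longrightarrow> n < card A \<Longrightarrow> bval \<theta> s (BNot (ILess (get 0) (get 12)))"
      using input_array(1)[of \<omega> A N st "o' n" s, OF _ A] by (simp add: I_def)
    show "I (card A) s \<Longrightarrow> \<not> bval \<theta> s (BNot (ILess (get 0) (get 12)))"
      using input_array(1)[of \<omega> A N st "o' (card A)" s, OF _ A] by (simp add: I_def)
    assume n: "n < card A"
    define k where "k = xs ! n"
    have take: "set (take (Suc n) xs) = insert k (set (take n xs))"
      using n by (simp add: take_Suc_conv_app_nth xs(2) k_def)
    let ?o = "\<lambda>f i k' i'. if k' = k \<and> i' = i then code (st 0 k i) - 1 else f k' i'"
    let ?at = "\<lambda>s. ints s 7 0 = T \<and> ints s 12 0 = 1 + int n"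
    define o1 where "o1 = ?o (o' n) W"
    define o2 where "o2 = ?o o1 R"
    define o3 where "o3 = ?o o2 L"
    define b1 where "b1 \<longleftrightarrow> ok n \<and> st 0 k W \<noteq> None"
    define b2 where "b2 \<longleftrightarrow> b1 \<and> st 0 k R \<noteq> None"
    define b3 where "b3 \<longleftrightarrow> b2 \<and> st 0 k L \<noteq> None"
    have o3: "o3 = o' (Suc n)"
    proof (intro ext)
      fix j i show "o3 j i = o' (Suc n) j i"
        by (cases i) (auto simp: o3_def o2_def o1_def o'_def take)
    qed
    have all: "(\<forall>i. P i) \<longleftrightarrow> P W \<and> P R \<and> P L" for P
      by (metis comp.exhaust)
    have b3: "b3 \<longleftrightarrow> ok (Suc n)"
      by (auto simp: b3_def b2_def b1_def ok_def take all)
    have "total \<theta> \<omega> (check_cell W) (I n) (\<lambda>s. represents \<omega> A N st o1 s \<and> ints s 7 0 = T \<and> ints s 12 0 = 1 + int n \<and> ints s 11 0 = of_bool b1)"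
      using total_check_cell[OF A n, of \<omega> W N st "o' n" T "ok n"]
      unfolding I_def[abs_def] o1_def b1_def k_def xs_def .
    moreover have "total \<theta> \<omega> (check_cell R) (\<lambda>s. represents \<omega> A N st o1 s \<and> ints s 7 0 = T \<and> ints s 12 0 = 1 + int n \<and> ints s 11 0 = of_bool b1)
        (\<lambda>s. represents \<omega> A N st o2 s \<and> ints s 7 0 = T \<and> ints s 12 0 = 1 + int n \<and> ints s 11 0 = of_bool b2)"
      using total_check_cell[OF A n, of \<omega> R N st o1 T b1]
      unfolding o2_def b2_def k_def xs_def .
    moreover have "total \<theta> \<omega> (check_cell L) (\<lambda>s. represents \<omega> A N st o2 s \<and> ints s 7 0 = T \<and> ints s 12 0 = 1 + int n \<and> ints s 11 0 = of_bool b2)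
        (\<lambda>s. represents \<omega> A N st o3 s \<and> ints s 7 0 = T \<and> ints s 12 0 = 1 + int n \<and> ints s 11 0 = of_bool b3)"
      using total_check_cell[OF A n, of \<omega> L N st o2 T b2]
      unfolding o3_def b3_def k_def xs_def .
    moreover have "total \<theta> \<omega> (incr 12)
        (\<lambda>s. represents \<omega> A N st o3 s \<and> ints s 7 0 = T \<and> ints s 12 0 = 1 + int n \<and> ints s 11 0 = of_bool b3) (I (Suc n))"
      by (rule total_incr, simp add: I_def represents_put o3 b3) (simp add: store_def)
    ultimately show "total \<theta> \<omega> (Seq (check_cell W) (Seq (check_cell R) (Seq (check_cell L) (incr 12)))) (I n) (I (Suc n))"
      by (intro total_Seq)
  qed
  then show ?thesis
    by (rule total_weaken) (simp_all add: I_def o'_def ok_def xs(1) xs(2)[symmetric])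
qed

definition success :: "(nat \<Rightarrow> real) \<Rightarrow> int set \<Rightarrow> nat \<Rightarrow> bool" where
  "success \<omega> A T \<longleftrightarrow> (\<forall>k\<in>A. \<forall>i. known \<omega> {- int T..int T} T 0 k i \<noteq> None)"

text \<open>\<open>T\<close> is the next depth, so flag and output come from depth
  \<open>T - 1\<close>, and the zero memory provides the flag before the first round. The vanishing
  of \<open>st\<close> outside the old window is the unknown boundary for the next sweep.\<close>

definition loop_inv :: "(nat \<Rightarrow> real) \<Rightarrow> int set \<Rightarrow> nat \<Rightarrow> memory \<Rightarrow> bool" where
  "loop_inv \<omega> A T s \<longleftrightarrow> (\<exists>N st out. represents \<omega> A N st out s \<and> ints s 7 0 = int T \<and>
     (\<forall>t k i. T \<le> t \<or> int T < \<bar>k\<bar> \<longrightarrow> st t k i = None) \<and>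
     (case T of 0 \<Rightarrow> ints s 11 0 = 0
      | Suc T' \<Rightarrow> ints s 11 0 = of_bool (success \<omega> A T') \<and>
          (\<forall>k\<in>A. \<forall>i. out k i = code (known \<omega> {- int T'..int T'} T' 0 k i) - 1)))"

lemma total_body:
  assumes A: "finite A"
  shows "total \<theta> \<omega> body (loop_inv \<omega> A T) (loop_inv \<omega> A (Suc T))"
  unfolding total_def
proof (intro allI impI)
  fix s assume "loop_inv \<omega> A T s"
  then obtain N st out where s: "represents \<omega> A N st out s" "ints s 7 0 = int T"
    and st: "\<And>t k i. T \<le> t \<or> int T < \<bar>k\<bar> \<Longrightarrow> st t k i = None"
    unfolding loop_inv_def by blast
  let ?kn = "\<lambda>t. known \<omega> {- int T..int T} (T - t) t"
  obtain s1 N' where s1: "exec \<theta> \<omega> fill s s1" "represents \<omega> A N' st out s1" "ints s1 7 0 = int T"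
      "(int T + int T * int T + 1) * (int T + int T * int T + 1) \<le> int N'"
    using total_fill[of \<omega> A N st out T] s unfolding total_def by blast
  obtain s2 where s2: "exec \<theta> \<omega> sweep s1 s2" "represents \<omega> A N' ?kn out s2" "ints s2 7 0 = int T"
  proof -
    have "total \<theta> \<omega> sweep (\<lambda>s. represents \<omega> A N' st out s \<and> ints s 7 0 = int T)
        (\<lambda>s. represents \<omega> A N' ?kn out s \<and> ints s 7 0 = int T)"
      by (rule total_sweep[OF s1(4)]) (rule st)
    then show ?thesis using that s1 unfolding total_def by blast
  qed
  let ?out = "\<lambda>k i. if k \<in> A then code (?kn 0 k i) - 1 else out k i"
  obtain s3 where s3: "exec \<theta> \<omega> check s2 s3" "represents \<omega> A N' ?kn ?out s3" "ints s3 7 0 = int T"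
      "ints s3 11 0 = of_bool (\<forall>k\<in>A. \<forall>i. ?kn 0 k i \<noteq> None)"
    using total_check[OF A, of \<omega> N' ?kn out "int T"] s2 unfolding total_def by blast
  define s4 where "s4 = s3\<lparr>ints := store 7 0 (int T + 1) (ints s3)\<rparr>"
  have s4: "exec \<theta> \<omega> (incr 7) s3 s4"
    using exec_ISet[of \<theta> \<omega> 7 "IConst 0" "IAdd (get 7) (IConst 1)" s3] s3 by (simp add: incr_def s4_def)
  have "?kn t k i = None" if "Suc T \<le> t \<or> int (Suc T) < \<bar>k\<bar>" for t k i
    using that by (cases "T - t") (auto simp: abs_le_iff)
  then have "loop_inv \<omega> A (Suc T) s4"
    unfolding loop_inv_def s4_def
    using s3 by (intro exI[of _ N'] exI[of _ ?kn] exI[of _ ?out])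
      (simp add: represents_put success_def, simp add: store_def)
  moreover have "exec \<theta> \<omega> body s s4"
    unfolding body_def using s1(1) s2(1) s3(1) s4 by (blast intro: exec_Seq)
  ultimately show "\<exists>s'. exec \<theta> \<omega> body s s' \<and> loop_inv \<omega> A (Suc T) s'" by blast
qed

lemma loop_inv_input: "loop_inv \<omega> A 0 (input A)"
proof -
  have "represents \<omega> A 0 (\<lambda>_ _ _. None) (\<lambda>_ _. 0) (input A)"
    by (auto simp: represents_def input_def code_def out_array_simps)
  moreover have "ints (input A) 7 0 = 0" "ints (input A) 11 0 = 0" by (simp_all add: input_def)
  ultimately show ?thesis unfolding loop_inv_def by fastforce
qed

text \<open>The program stops at the least successful depth, yet any depth may appear on the right:
  values once known agree at all depths. This consistency makes stopping early harmless.\<close>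

lemma outputs_sampler_iff:
  assumes A: "finite A"
  shows "outputs \<theta> sampler A \<omega> w \<longleftrightarrow> (\<exists>T. \<forall>k\<in>A. \<forall>i. known \<omega> {- int T..int T} T 0 k i = Some (w k i))"
proof -
  obtain S where S: "\<And>n. loop_inv \<omega> A n (S n)"
    and run: "\<And>s'. exec \<theta> \<omega> sampler (input A) s' \<longleftrightarrow>
      (\<exists>n. (\<forall>m<n. bval \<theta> (S m) (ILess (get 11) (IConst 1))) \<and> \<not> bval \<theta> (S n) (ILess (get 11) (IConst 1)) \<and> s' = S n)"
    using exec_While_iff[where I = "loop_inv \<omega> A", OF total_body[OF A] loop_inv_input]
    unfolding sampler_def by metis
  have flag: "bval \<theta> (S n) (ILess (get 11) (IConst 1)) \<longleftrightarrow> \<not> (\<exists>T. n = Suc T \<and> success \<omega> A T)" for n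
    using S[of n] by (cases n) (auto simp: loop_inv_def)
  have res: "(\<forall>k\<in>A. \<forall>i. ints (S (Suc T)) (out_array i) k = of_bool (w k i)) \<longleftrightarrow>
      (\<forall>k\<in>A. \<forall>i. known \<omega> {- int T..int T} T 0 k i = Some (w k i))" for T
  proof -
    have code: "code v - 1 = of_bool b \<longleftrightarrow> v = Some b" for v b
      by (cases v) (auto simp: code_def)
    have "ints (S (Suc T)) (out_array i) k = code (known \<omega> {- int T..int T} T 0 k i) - 1" if "k \<in> A" for k i
      using S[of "Suc T"] that by (auto simp: loop_inv_def represents_def)
    then show ?thesis using code by (metis (no_types, lifting))
  qed
  show ?thesis
  proof
    assume "outputs \<theta> sampler A \<omega> w"
    then obtain n where "\<not> bval \<theta> (S n) (ILess (get 11) (IConst 1))"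
        "\<forall>k\<in>A. \<forall>i. ints (S n) (out_array i) k = of_bool (w k i)"
      unfolding outputs_def run by blast
    moreover from this(1) obtain T where "n = Suc T" unfolding flag by blast
    ultimately show "\<exists>T. \<forall>k\<in>A. \<forall>i. known \<omega> {- int T..int T} T 0 k i = Some (w k i)"
      using res[of T] by (intro exI[of _ T]) simp
  next
    assume "\<exists>T. \<forall>k\<in>A. \<forall>i. known \<omega> {- int T..int T} T 0 k i = Some (w k i)"
    then obtain T where T: "\<And>k i. k \<in> A \<Longrightarrow> known \<omega> {- int T..int T} T 0 k i = Some (w k i)" by blast
    then have "success \<omega> A T" by (simp add: success_def)
    define T0 where "T0 = (LEAST T. success \<omega> A T)"
    have T0: "success \<omega> A T0" "\<And>T. T < T0 \<Longrightarrow> \<not> success \<omega> A T"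
      unfolding T0_def using LeastI[of "success \<omega> A", OF \<open>success \<omega> A T\<close>] not_less_Least by auto
    have "known \<omega> {- int T0..int T0} T0 0 k i = Some (w k i)" if "k \<in> A" for k i
    proof -
      obtain b where "known \<omega> {- int T0..int T0} T0 0 k i = Some b"
        using T0(1) \<open>k \<in> A\<close> by (auto simp: success_def)
      moreover from this have "b = w k i" using T[OF that] by (rule known_Some_unique)
      ultimately show ?thesis by simp
    qed
    then have "\<forall>k\<in>A. \<forall>i. ints (S (Suc T0)) (out_array i) k = of_bool (w k i)"
      using res by blast
    moreover have "exec \<theta> \<omega> sampler (input A) (S (Suc T0))"
      unfolding run flag using T0 by (intro exI[of _ "Suc T0"]) auto
    ultimately show "outputs \<theta> sampler A \<omega> w" unfolding outputs_def by blast
  qed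
qed

text \<open>Depth and window grow together, so the window finally contains the light cones of depth
  \<open>n\<close> of all sites in \<open>A\<close>.\<close>

lemma known_eventually_window:
  assumes "finite A" and "\<And>k i. k \<in> A \<Longrightarrow> known \<omega> UNIV n 0 k i = Some (w k i)"
  shows "\<exists>T. \<forall>k\<in>A. \<forall>i. known \<omega> {- int T..int T} T 0 k i = Some (w k i)"
proof -
  \<comment> \<open>The sum serves as a common bound for the absolute values of the sites in
    \<open>A\<close>.\<close>
  define T where "T = n + (\<Sum>k\<in>A. nat \<bar>k\<bar>)"
  have "known \<omega> {- int T..int T} T 0 k i = Some (w k i)" if "k \<in> A" for k i
  proof -
    have "nat \<bar>k\<bar> \<le> (\<Sum>k\<in>A. nat \<bar>k\<bar>)"
      using member_le_sum[OF that, of "\<lambda>k. nat \<bar>k\<bar>"] assms(1) by simp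
    then have "nat \<bar>k\<bar> + n \<le> T" unfolding T_def by linarith
    then have "\<bar>k\<bar> + int n \<le> int T" by linarith
    then have window: "{k - int n..k + int n} \<subseteq> {- int T..int T}" by auto
    have "known \<omega> {- int T..int T} n 0 k i = Some (w k i)"
      unfolding known_restrict[OF window] by (rule assms(2)[OF that])
    then show ?thesis by (rule known_mono) (simp_all add: T_def)
  qed
  then show ?thesis by blast
qed

text \<open>An output is always the restriction of \<open>limit_conf\<close>. Conversely the output
  can be missing only on \<open>unknown A n\<close> for every \<open>n\<close>, an event of
  arbitrarily small probability, which also disposes of runs that never stop.\<close>

lemma perfect_sampler_limit_measure: "perfect_sampler \<theta> sampler limit_measure"
  unfolding perfect_sampler_def
proof (intro allI impI)
  fix A :: "int set" and w :: conf
  assume A: "finite A"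
  let ?E = "{\<omega>. outputs \<theta> sampler A \<omega> w}" and ?Z = "{\<omega>. limit_conf \<omega> \<in> cylinder A w}"
  have "Measurable.pred uniform_samples (\<lambda>\<omega>. \<exists>T. \<forall>p\<in>A \<times> UNIV.
      known \<omega> {- int T..int T} T 0 (fst p) (snd p) = Some (w (fst p) (snd p)))"
    using A by (intro pred_intros_countable pred_intros_finite measurable_known_eq) auto
  then have ev: "?E \<in> samples.events"
    unfolding outputs_sampler_iff[OF A] by (simp add: pred_def)
  have sub: "?E \<subseteq> ?Z"
    unfolding outputs_sampler_iff[OF A] cylinder_def
    by (auto simp: fun_eq_iff dest: known_imp_limit_conf)
  have sup: "?Z \<subseteq> ?E \<union> unknown A n" for n
  proof
    fix \<omega> assume \<omega>: "\<omega> \<in> ?Z"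
    show "\<omega> \<in> ?E \<union> unknown A n"
    proof (cases "\<omega> \<in> unknown A n")
      case False
      have "known \<omega> UNIV n 0 k i = Some (w k i)" if k: "k \<in> A" for k i
      proof -
        obtain b where b: "known \<omega> UNIV n 0 k i = Some b"
          using False k unfolding unknown_def by fastforce
        then have "b = w k i"
          using known_imp_limit_conf[OF b] \<omega> k by (simp add: cylinder_def)
        with b show ?thesis by simp
      qed
      then have "outputs \<theta> sampler A \<omega> w"
        unfolding outputs_sampler_iff[OF A] by (rule known_eventually_window[OF A])
      then show ?thesis by simp
    qed simp
  qed
  have "\<bar>samples.prob ?E - samples.prob ?Z\<bar> \<le> 3 * card A * gap n" for n
    using samples.abs_prob_diff_le[OF ev limit_conf_events[OF A] unknown_events[OF A] _ sup, of n]
      sub prob_unknown[OF A, of n] by (meson le_supI1 order_trans)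
  moreover have "(\<lambda>n. 3 * card A * gap n) \<longlonglongrightarrow> 0"
    using tendsto_mult_right_zero[OF gap_tendsto_0] .
  ultimately have "\<bar>samples.prob ?E - samples.prob ?Z\<bar> \<le> 0"
    by (intro LIMSEQ_le_const[of _ 0]) auto
  then show "{\<omega> \<in> space uniform_samples. outputs \<theta> sampler A \<omega> w} \<in> sets uniform_samples \<and>
      measure uniform_samples {\<omega> \<in> space uniform_samples. outputs \<theta> sampler A \<omega> w} =
        measure limit_measure (cylinder A w)"
    using ev by (simp add: measure_limit_measure[OF A])
qed

end

theorem theorem3p14:
  fixes \<beta> \<delta> :: "comp \<Rightarrow> real" and \<Phi> :: "conf \<Rightarrow> conf measure"
  assumes "positive_rates \<beta> \<delta>"
    and "noisy_version gliders (birth_death \<beta> \<delta>) \<Phi>"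
  shows "uniformly_ergodic \<Phi> \<and>
    (\<forall>\<pi>. invariant \<Phi> \<pi> \<longrightarrow>
       spatially_mixing \<pi> \<and> admits_perfect_sampling (birth_death \<beta> \<delta>) \<pi>)"
proof -
  interpret noisy_gliders \<beta> \<delta> \<Phi>
    by unfold_locales (fact assms)+
  show ?thesis
    unfolding admits_perfect_sampling_def
    using uniformly_ergodic spatially_mixing_limit_measure perfect_sampler_limit_measure invariant_unique
    by blast
qed

end
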